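(* Let $r\ge 2$ be a fixed integer and let $\mathbb{RM}_n$ denote a uniformly random ordered $r$-matching of size $n$ on the vertex set $[rn]$. Then asymptotically almost surely $t(\mathbb{RM}_n)=\Theta\left(n^{\frac{2}{r+1}}\right)$; that is, there exist constants $0<c\le C$ (depending only on $r$) such that $$\lim_{n\to\infty}\mathbb{P}\left(c\, n^{\frac{2}{r+1}}\le t(\mathbb{RM}_n)\le C\, n^{\frac{2}{r+1}}\right)=1.$$
   Context: An ordered $r$-matching of size $n$ is an $r$-uniform hypergraph on a linearly ordered vertex set $V$ with $|V|=rn$, consisting of $n$ pairwise disjoint edges (equivalently, a word with $n$ distinct letters each occurring exactly $r$ times). Two ordered matchings are isomorphic if there is an order-preserving bijection between their vertex sets inducing a bijection between their edge sets. A pair of twins in an ordered matching $M$ is a pair of vertex-disjoint sub-matchings of $M$ (sub-matching = subset of the edges) that are isomorphic as ordered matchings; the size of the twins is the number of edges in one of them. $t(M)$ denotes the maximum size of twins in $M$. $\mathbb{RM}_n$ is chosen uniformly among all $\frac{(rn)!}{(r!)^n n!}$ $r$-matchings on $[rn]$ (with the natural order). *)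

theory Defs
  imports "HOL-Probability.Probability"
begin

definition ordered_matching :: "nat \<Rightarrow> nat \<Rightarrow> 'a::linorder set \<Rightarrow> 'a set set \<Rightarrow> bool" where
  "ordered_matching r n V M \<longleftrightarrow>
     finite V \<and> card V = r * n \<and> (\<forall>e\<in>M. e \<subseteq> V \<and> card e = r) \<and> pairwise disjnt M \<and> card M = n"

text \<open>A matching is represented by its edge set. Its edges cover all vertices (there are
  \<open>n\<close> disjoint edges of size \<open>r\<close> on \<open>r * n\<close> vertices), so its vertex set is the union of the
  edges; the same applies to a sub-matching, on the vertices covered by its edges.\<close>

definition matching_iso :: "'a::linorder set set \<Rightarrow> 'b::linorder set set \<Rightarrow> bool" where
  "matching_iso A B \<longleftrightarrow>
     (\<exists>f. bij_betw f (\<Union>A) (\<Union>B) \<and> strict_mono_on (\<Union>A) f \<and> bij_betw (image f) A B)"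

definition twins :: "'a::linorder set set \<Rightarrow> 'a set set \<Rightarrow> 'a set set \<Rightarrow> bool" where
  "twins M A B \<longleftrightarrow> A \<subseteq> M \<and> B \<subseteq> M \<and> \<Union>A \<inter> \<Union>B = {} \<and> matching_iso A B"

text \<open>The maximum exists for every finite \<open>M\<close>: the empty pair of twins has size 0.\<close>

definition max_twins :: "'a::linorder set set \<Rightarrow> nat" where
  "max_twins M = Max {card A | A B. twins M A B}"

definition ordered_matchings :: "nat \<Rightarrow> nat \<Rightarrow> nat set set set" where
  "ordered_matchings r n = {M. ordered_matching r n {1..r * n} M}"

definition random_matching :: "nat \<Rightarrow> nat \<Rightarrow> nat set set pmf" where
  "random_matching r n = pmf_of_set (ordered_matchings r n)"

text \<open>The next two lemmas ensure that \<open>pmf_of_set\<close> is the uniform distribution, and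
  the last one that \<open>Max\<close> is a maximum.\<close>

lemma finite_ordered_matchings: "finite (ordered_matchings r n)"
proof (rule finite_subset)
  show "ordered_matchings r n \<subseteq> Pow (Pow {1..r * n})"
    by (auto simp: ordered_matchings_def ordered_matching_def)
qed simp

lemma ordered_matchings_nonempty:
  assumes "r > 0"
  shows "ordered_matchings r n \<noteq> {}"
proof -
  define e where "e = (\<lambda>i::nat. {r * i<..r * Suc i})"
  have less: "r * Suc i \<le> r * j" if "i < j" for i j :: nat
    using that by (intro mult_le_mono2) simp
  have dis: "e i \<inter> e j = {}" if "i < j" for i j
    using less[OF that] by (auto simp: e_def)
  hence dis': "disjnt (e i) (e j)" if "i \<noteq> j" for i j
    using that by (metis disjnt_def inf_commute linorder_neqE_nat)
  have card: "card (e i) = r" for i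
    by (simp add: e_def)
  have inj: "inj_on e {..<n}"
  proof (rule inj_onI, rule ccontr)
    fix i j assume "e i = e j" "i \<noteq> j"
    hence "e i = {}" using dis'[of i j] by (simp add: disjnt_def)
    with card[of i] assms show False by simp
  qed
  have "e i \<subseteq> {1..r * n}" if "i < n" for i
    using less[OF that] by (auto simp: e_def)
  moreover have "pairwise disjnt (e ` {..<n})"
    using dis' by (intro pairwise_imageI) auto
  ultimately have "ordered_matching r n {1..r * n} (e ` {..<n})"
    using inj by (simp add: ordered_matching_def card card_image)
  thus ?thesis
    by (auto simp: ordered_matchings_def)
qed

lemma twins_sizes:
  assumes "finite M"
  shows "finite {card A | A B. twins M A B}" "{card A | A B. twins M A B} \<noteq> {}"
proof -
  have "{card A | A B. twins M A B} \<subseteq> card ` Pow M"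
    by (auto simp: twins_def)
  thus "finite {card A | A B. twins M A B}"
    by (rule finite_subset) (use assms in simp)
  have "twins M {} {}"
    by (auto simp: twins_def matching_iso_def strict_mono_on_def)
  thus "{card A | A B. twins M A B} \<noteq> {}"
    by blast
qed

end

theory Submission
  imports Defs "HOL-Real_Asymp.Real_Asymp"
begin

text \<open>A labelling is an injective numbering of the \<open>r * n\<close> vertices by cells \<open>(i, s)\<close>, where row \<open>i\<close>
  forms an edge; a uniformly random labelling gives a uniformly random matching.

  Upper bound: fix the \<open>k\<close> rows of one twin and a cellwise correspondence with rows outside. The
  relative order of the \<open>r * k\<close> chosen cells is then prescribed, which has probability
  \<open>1 / (r * k)!\<close>. The union bound over all correspondences is at most
  \<open>((e / k) ^ (r + 1) * n\<^sup>2) ^ k\<close>.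

  Lower bound: place the cells independently in a long interval that is cut into
  \<open>m = \<lfloor>n powr (2 / (r + 1)) / 16\<rfloor>\<close> blocks. Two edges with the same \<open>r\<close>-tuple of distinct blocks
  can be put into different twins, and several such pairs can be combined if they use disjoint sets
  of blocks. If a maximal family of pairs uses at most \<open>m / 2\<close> blocks, then no tuple with distinct
  entries in the set \<open>E\<close> of the remaining blocks is repeated. By the birthday paradox this has
  probability at most \<open>exp (- const * n\<^sup>2 / m ^ r)\<close>, up to a factor linear in \<open>n\<close>, and this beats the
  \<open>2 ^ m\<close> choices of \<open>E\<close>.\<close>

section \<open>Labellings\<close>

definition cells :: "nat \<Rightarrow> nat \<Rightarrow> (nat \<times> nat) set" where
  "cells r n = {..<n} \<times> {..<r}"

text \<open>Extensional functions, so that labellings can be counted. As both sides have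
  \<open>r * n\<close> elements, injectivity already makes them bijections.\<close>

definition labellings :: "nat \<Rightarrow> nat \<Rightarrow> (nat \<times> nat \<Rightarrow> nat) set" where
  "labellings r n = {h \<in> cells r n \<rightarrow>\<^sub>E {1..r * n}. inj_on h (cells r n)}"

definition row_edge :: "nat \<Rightarrow> (nat \<times> nat \<Rightarrow> nat) \<Rightarrow> nat \<Rightarrow> nat set" where
  "row_edge r h i = h ` ({i} \<times> {..<r})"

definition matching_of :: "nat \<Rightarrow> nat \<Rightarrow> (nat \<times> nat \<Rightarrow> nat) \<Rightarrow> nat set set" where
  "matching_of r n h = row_edge r h ` {..<n}"

lemma finite_cells [simp]: "finite (cells r n)"
  and card_cells [simp]: "card (cells r n) = r * n"
  by (simp_all add: cells_def mult.commute)

lemma finite_labellings [simp]: "finite (labellings r n)"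
  unfolding labellings_def by (rule finite_subset[of _ "cells r n \<rightarrow>\<^sub>E {1..r * n}"])
    (auto intro: finite_PiE)

lemma labellings_bij: "h \<in> labellings r n \<Longrightarrow> bij_betw h (cells r n) {1..r * n}"
  unfolding labellings_def bij_betw_def
  using card_subset_eq[of "{1..r * n}" "h ` cells r n"] by (auto simp: card_image)

lemma row_edge_disjoint:
  assumes "inj_on h (cells r n)" "i < n" "j < n" "i \<noteq> j"
  shows "row_edge r h i \<inter> row_edge r h j = {}"
proof -
  have "h (i, s) \<noteq> h (j, t)" if "s < r" "t < r" for s t
    using assms inj_onD[OF assms(1), of "(i, s)" "(j, t)"] that by (auto simp: cells_def)
  thus ?thesis by (auto simp: row_edge_def)
qed

lemma row_edge_eq_iff:
  assumes "inj_on h (cells r n)" "0 < r" "i < n" "j < n"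
  shows "row_edge r h i = row_edge r h j \<longleftrightarrow> i = j"
proof -
  have "row_edge r h i \<noteq> {}" using assms(2) by (auto simp: row_edge_def)
  thus ?thesis using row_edge_disjoint[OF assms(1,3,4)] by auto
qed

lemma card_row_edge:
  assumes "inj_on h (cells r n)" "i < n"
  shows "card (row_edge r h i) = r"
proof -
  have "inj_on h ({i} \<times> {..<r})"
    by (rule inj_on_subset[OF assms(1)]) (use assms(2) in \<open>auto simp: cells_def\<close>)
  thus ?thesis by (simp add: row_edge_def card_image)
qed

lemma matching_of_in_ordered_matchings:
  assumes "0 < r" and h: "h \<in> labellings r n"
  shows "matching_of r n h \<in> ordered_matchings r n"
proof -
  have inj: "inj_on h (cells r n)" using h by (simp add: labellings_def)
  have "card (matching_of r n h) = n"
    unfolding matching_of_def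
    by (subst card_image) (auto intro!: inj_onI simp: row_edge_eq_iff[OF inj \<open>0 < r\<close>])
  moreover have "row_edge r h i \<subseteq> {1..r * n}" if "i < n" for i
    using h that by (auto simp: labellings_def row_edge_def cells_def PiE_iff)
  moreover have "pairwise disjnt (matching_of r n h)"
    unfolding matching_of_def
    by (intro pairwise_imageI) (use row_edge_disjoint[OF inj] in \<open>auto simp: disjnt_def\<close>)
  ultimately show ?thesis
    using card_row_edge[OF inj]
    by (auto simp: ordered_matchings_def ordered_matching_def matching_of_def)
qed

text \<open>Number the edges by \<open>E\<close> and the vertices of each edge \<open>e\<close> by
  \<open>d e\<close>, both arbitrarily; disjointness of the edges makes the combined map injective.
  Hence no fibre of \<open>matching_of\<close> over an ordered matching is empty.\<close>

lemma ex_labelling: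
  assumes "M \<in> ordered_matchings r n"
  shows "\<exists>h\<in>labellings r n. matching_of r n h = M"
proof -
  have M: "e \<subseteq> {1..r * n}" "card e = r" if "e \<in> M" for e
    using assms that by (auto simp: ordered_matchings_def ordered_matching_def)
  have dis: "pairwise disjnt M" and cM: "card M = n"
    using assms by (auto simp: ordered_matchings_def ordered_matching_def)
  have "finite M" by (rule finite_subset[of _ "Pow {1..r * n}"]) (use M in auto)
  then obtain E where E: "bij_betw E {..<n} M"
    using ex_bij_betw_nat_finite[of M] cM by (auto simp: atLeast0LessThan)
  have "\<exists>d. bij_betw d {..<r} e" if "e \<in> M" for e
    using ex_bij_betw_nat_finite[of e] M[OF that] finite_subset[of e "{1..r * n}"]
    by (auto simp: atLeast0LessThan)
  then obtain d where d: "\<And>e. e \<in> M \<Longrightarrow> bij_betw (d e) {..<r} e" by metis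
  define h where "h = (\<lambda>(i, s)\<in>cells r n. d (E i) s)"
  have EM: "E i \<in> M" if "i < n" for i using E that by (auto simp: bij_betw_def)
  have h_eq: "h (i, s) = d (E i) s" if "i < n" "s < r" for i s
    using that by (simp add: h_def cells_def)
  have h_in: "h (i, s) \<in> E i" if "i < n" "s < r" for i s
    using d[OF EM[OF that(1)]] that by (auto simp: h_eq bij_betw_def)
  have "inj_on h (cells r n)"
  proof (rule inj_onI, clarsimp simp: cells_def)
    fix i s j t assume *: "i < n" "s < r" "j < n" "t < r" "h (i, s) = h (j, t)"
    have "E i = E j"
      using h_in[of i s] h_in[of j t] * dis EM[of i] EM[of j]
      by (auto simp: pairwise_def disjnt_def)
    hence "i = j" using E * by (auto simp: bij_betw_def inj_on_def)
    moreover have "s = t"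
      using * d[OF EM[of i]] \<open>i = j\<close> by (auto simp: h_eq bij_betw_def inj_on_def)
    ultimately show "i = j \<and> s = t" by simp
  qed
  moreover have "h \<in> cells r n \<rightarrow>\<^sub>E {1..r * n}"
  proof (rule PiE_I)
    fix x assume "x \<in> cells r n"
    then obtain i s where x: "x = (i, s)" "i < n" "s < r" by (auto simp: cells_def)
    show "h x \<in> {1..r * n}" using h_in[OF x(2,3)] M(1)[OF EM[OF x(2)]] x(1) by blast
  qed (simp add: h_def)
  moreover have "row_edge r h i = E i" if "i < n" for i
  proof -
    have "row_edge r h i = d (E i) ` {..<r}"
      using that by (auto simp: row_edge_def h_eq image_iff)
    thus ?thesis using d[OF EM[OF that]] by (simp add: bij_betw_def)
  qed
  hence "row_edge r h ` {..<n} = E ` {..<n}" by (intro image_cong) auto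
  hence "matching_of r n h = M"
    using E by (simp add: matching_of_def bij_betw_def)
  ultimately show ?thesis by (auto simp: labellings_def)
qed

text \<open>Any two matchings differ by a permutation of the vertices, and composing a labelling with
  it moves one fibre into the other.\<close>

lemma card_labellings_fibre_le:
  assumes "M \<in> ordered_matchings r n" "M' \<in> ordered_matchings r n"
  shows "card {h \<in> labellings r n. matching_of r n h = M}
       \<le> card {h \<in> labellings r n. matching_of r n h = M'}"
proof -
  let ?X = "cells r n" and ?L = "labellings r n"
  obtain a where a: "a \<in> ?L" "matching_of r n a = M"
    using ex_labelling[OF assms(1)] by blast
  obtain b where b: "b \<in> ?L" "matching_of r n b = M'"
    using ex_labelling[OF assms(2)] by blast
  define p where "p = b \<circ> inv_into ?X a"
  have p: "bij_betw p {1..r * n} {1..r * n}"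
    unfolding p_def
    by (rule bij_betw_trans[OF bij_betw_inv_into[OF labellings_bij[OF a(1)]] labellings_bij[OF b(1)]])
  define c where "c = (\<lambda>h. restrict (p \<circ> h) ?X)"
  have c_in: "c h \<in> ?L" if "h \<in> ?L" for h
  proof -
    have "inj_on (p \<circ> h) ?X"
      using p labellings_bij[OF that] by (intro comp_inj_on) (simp_all add: bij_betw_def)
    moreover have "p (h x) \<in> {1..r * n}" if "x \<in> ?X" for x
      using bij_betw_apply[OF labellings_bij[OF \<open>h \<in> ?L\<close>] that] bij_betw_apply[OF p] by blast
    hence "c h \<in> ?X \<rightarrow>\<^sub>E {1..r * n}" unfolding c_def by (intro PiE_I) (simp_all add: o_def)
    ultimately show ?thesis by (simp add: labellings_def c_def inj_on_restrict_eq)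
  qed
  have inj: "inj_on c ?L"
  proof (rule inj_onI)
    fix h h' assume *: "h \<in> ?L" "h' \<in> ?L" "c h = c h'"
    have "h x = h' x" if "x \<in> ?X" for x
    proof -
      have "p (h x) = p (h' x)" using fun_cong[OF *(3), of x] that by (simp add: c_def)
      thus ?thesis
        using bij_betw_apply[OF labellings_bij[OF *(1)] that]
          bij_betw_apply[OF labellings_bij[OF *(2)] that] p
        by (meson bij_betw_imp_inj_on inj_onD)
    qed
    thus "h = h'" using * unfolding labellings_def by (blast intro: PiE_ext)
  qed
  have m: "matching_of r n (c h) = image p ` matching_of r n h" for h
    unfolding matching_of_def image_image
  proof (rule image_cong)
    fix i assume "i \<in> {..<n}"
    hence "c h x = p (h x)" if "x \<in> {i} \<times> {..<r}" for x
      using that by (auto simp: c_def cells_def)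
    thus "row_edge r (c h) i = p ` row_edge r h i"
      unfolding row_edge_def image_image by (rule image_cong[OF refl])
  qed simp
  have "c a = b"
  proof
    fix x
    show "c a x = b x"
    proof (cases "x \<in> ?X")
      case True
      thus ?thesis using labellings_bij[OF a(1)] by (simp add: c_def p_def bij_betw_def)
    next
      case False
      have "b \<in> ?X \<rightarrow>\<^sub>E {1..r * n}" using b(1) by (simp add: labellings_def)
      thus ?thesis using False PiE_arb[of b ?X _ x] by (simp add: c_def)
    qed
  qed
  hence "M' = image p ` M" using m[of a] a b by simp
  hence "c ` {h \<in> ?L. matching_of r n h = M} \<subseteq> {h \<in> ?L. matching_of r n h = M'}"
    using c_in m by auto
  thus ?thesis
    using inj by (intro card_inj_on_le[of c]) (auto intro: inj_on_subset)
qed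

text \<open>All fibres of \<open>matching_of\<close> over ordered matchings have the same positive
  size \<open>f\<close>, which cancels in the quotient. From here on, probabilities are ratios of
  numbers of labellings.\<close>

lemma prob_random_matching:
  assumes "0 < r"
  shows "measure_pmf.prob (random_matching r n) X =
    real (card {h \<in> labellings r n. matching_of r n h \<in> X}) / real (card (labellings r n))"
proof -
  let ?L = "labellings r n" and ?O = "ordered_matchings r n" and ?m = "matching_of r n"
  have fin: "finite ?O" and ne: "?O \<noteq> {}"
    using finite_ordered_matchings ordered_matchings_nonempty[OF assms] by auto
  obtain M0 where M0: "M0 \<in> ?O" using ne by blast
  define f where "f = card {h \<in> ?L. ?m h = M0}"
  have f: "card {h \<in> ?L. ?m h = M} = f" if "M \<in> ?O" for M
    unfolding f_def using card_labellings_fibre_le[OF that M0] card_labellings_fibre_le[OF M0 that]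
    by simp
  have "f > 0" using ex_labelling[OF M0] by (auto simp: f_def card_gt_0_iff)
  have count: "card {h \<in> ?L. ?m h \<in> Y} = card (?O \<inter> Y) * f" for Y
  proof -
    have "{h \<in> ?L. ?m h \<in> Y} = (\<Union>M\<in>?O \<inter> Y. {h \<in> ?L. ?m h = M})"
      using matching_of_in_ordered_matchings[OF assms] by auto
    also have "card \<dots> = (\<Sum>M\<in>?O \<inter> Y. card {h \<in> ?L. ?m h = M})"
      by (rule card_UN_disjoint) (use fin in auto)
    also have "\<dots> = card (?O \<inter> Y) * f" by (simp add: f)
    finally show ?thesis .
  qed
  have "card ?L = card ?O * f" using count[of UNIV] by simp
  thus ?thesis
    unfolding random_matching_def
    by (subst measure_pmf_of_set[OF ne fin]) (use \<open>f > 0\<close> count[of X] in simp)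
qed

section \<open>Twins expressed by rows and cells of a labelling\<close>

text \<open>The isomorphism sends \<open>h (i, s)\<close> to \<open>h (q i, s)\<close>.
  Correspondences that keep the position \<open>s\<close> are enough for constructing twins in the
  lower bound.\<close>

lemma ex_twins_of_labelling:
  assumes inj: "inj_on h (cells r n)" and "0 < r"
    and J: "J \<subseteq> {..<n}" and q: "inj_on q J" "q ` J \<subseteq> {..<n}" "q ` J \<inter> J = {}"
    and mono: "\<And>i j s t. \<lbrakk>i \<in> J; j \<in> J; s < r; t < r; h (i, s) < h (j, t)\<rbrakk> \<Longrightarrow> h (q i, s) < h (q j, t)"
  shows "\<exists>A B. twins (matching_of r n h) A B \<and> card A = card J"
proof -
  let ?X = "cells r n"
  define A where "A = row_edge r h ` J"
  define B where "B = row_edge r h ` q ` J"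
  define f where "f = (\<lambda>x. case inv_into ?X h x of (i, s) \<Rightarrow> h (q i, s))"
  have f: "f (h (i, s)) = h (q i, s)" if "i \<in> J" "s < r" for i s
  proof -
    have "inv_into ?X h (h (i, s)) = (i, s)"
      using inj J that by (intro inv_into_f_f) (auto simp: cells_def)
    thus ?thesis by (simp add: f_def)
  qed
  have UA: "x \<in> \<Union>A \<longleftrightarrow> (\<exists>i\<in>J. \<exists>s<r. x = h (i, s))" for x
    by (auto simp: A_def row_edge_def)
  have UB: "x \<in> \<Union>B \<longleftrightarrow> (\<exists>i\<in>J. \<exists>s<r. x = h (q i, s))" for x
    by (auto simp: B_def row_edge_def)
  have sm: "strict_mono_on (\<Union>A) f"
    by (rule strict_mono_onI) (unfold UA, auto simp: f intro: mono)
  have fe: "f ` row_edge r h i = row_edge r h (q i)" if "i \<in> J" for i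
    using f[OF that] by (force simp: row_edge_def)
  have "f ` \<Union>A = \<Union>B"
    unfolding A_def B_def image_Union image_image using fe by simp
  hence "bij_betw f (\<Union>A) (\<Union>B)"
    using sm strict_mono_on_imp_inj_on by (auto simp: bij_betw_def)
  moreover have "bij_betw (image f) A B"
  proof -
    have "inj_on (image f) A"
      using strict_mono_on_imp_inj_on[OF sm] by (rule inj_on_image)
    moreover have "image f ` A = B" unfolding A_def B_def image_image using fe by simp
    ultimately show ?thesis by (simp add: bij_betw_def)
  qed
  moreover have "\<Union>A \<inter> \<Union>B = {}"
  proof -
    have "row_edge r h i \<inter> row_edge r h (q j) = {}" if "i \<in> J" "j \<in> J" for i j
      using that J q by (intro row_edge_disjoint[OF inj]) auto
    thus ?thesis by (auto simp: A_def B_def)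
  qed
  moreover have "A \<subseteq> matching_of r n h" "B \<subseteq> matching_of r n h"
    using J q by (auto simp: A_def B_def matching_of_def)
  moreover have "card A = card J"
    unfolding A_def using J row_edge_eq_iff[OF inj \<open>0 < r\<close>]
    by (intro card_image inj_onI) blast
  ultimately show ?thesis using sm unfolding twins_def matching_iso_def by blast
qed

text \<open>The counterpart for the upper bound. The labelling inside an edge is arbitrary, so an
  isomorphism need not keep positions: \<open>fst (w i)\<close> is the partner row of row
  \<open>i\<close>, and \<open>snd (w i)\<close> tells where its positions go. Recording positions
  by an arbitrary map instead of a permutation leaves \<open>r ^ r\<close> possibilities per
  row.\<close>

lemma index_maps_of_twins:
  assumes inj: "inj_on h (cells r n)" and "0 < r" and tw: "twins (matching_of r n h) A B"
  shows "\<exists>I w. I \<subseteq> {..<n} \<and> card I = card A \<and>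
     (\<forall>i\<in>I. fst (w i) \<in> {..<n} - I \<and> snd (w i) \<in> {..<r} \<rightarrow>\<^sub>E {..<r}) \<and>
     (\<forall>i\<in>I. \<forall>j\<in>I. \<forall>s<r. \<forall>t<r. h (i, s) < h (j, t) \<longrightarrow>
        h (fst (w i), snd (w i) s) < h (fst (w j), snd (w j) t))"
proof -
  obtain f where f: "strict_mono_on (\<Union>A) f" "bij_betw (image f) A B"
    using tw by (auto simp: twins_def matching_iso_def)
  have AB: "A \<subseteq> matching_of r n h" "B \<subseteq> matching_of r n h" "\<Union>A \<inter> \<Union>B = {}"
    using tw by (auto simp: twins_def)
  define I where "I = {i \<in> {..<n}. row_edge r h i \<in> A}"
  have "A = row_edge r h ` I" using AB(1) by (auto simp: I_def matching_of_def)
  moreover have "inj_on (row_edge r h) I"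
    by (rule inj_onI) (use row_edge_eq_iff[OF inj \<open>0 < r\<close>] in \<open>auto simp: I_def\<close>)
  ultimately have card: "card I = card A" by (simp add: card_image)
  have "\<exists>v. fst v < n \<and> fst v \<notin> I \<and> snd v \<in> {..<r} \<rightarrow>\<^sub>E {..<r} \<and>
      (\<forall>s<r. f (h (i, s)) = h (fst v, snd v s))" if "i \<in> I" for i
  proof -
    have B: "f ` row_edge r h i \<in> B"
      using that f(2) by (auto simp: bij_betw_def I_def)
    then obtain j where j: "j < n" "f ` row_edge r h i = row_edge r h j"
      using AB(2) by (auto simp: matching_of_def)
    have "\<exists>t<r. f (h (i, s)) = h (j, t)" if "s < r" for s
    proof -
      have "f (h (i, s)) \<in> row_edge r h j" using j(2) that by (force simp: row_edge_def)
      thus ?thesis by (auto simp: row_edge_def)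
    qed
    then obtain t where t: "\<And>s. s < r \<Longrightarrow> t s < r \<and> f (h (i, s)) = h (j, t s)" by metis
    \<comment> \<open>A nonempty edge in \<open>B\<close> cannot also belong to \<open>A\<close>,
      because the two vertex sets are disjoint; so partner rows lie outside
      \<open>I\<close>.\<close>
    have "row_edge r h j \<noteq> {}" using \<open>0 < r\<close> by (auto simp: row_edge_def)
    hence "j \<notin> I" using AB(3) B j(2) by (auto simp: I_def)
    thus ?thesis using j t by (intro exI[of _ "(j, restrict t {..<r})"]) auto
  qed
  then obtain w where w: "\<And>i. i \<in> I \<Longrightarrow> fst (w i) < n \<and> fst (w i) \<notin> I \<and>
      snd (w i) \<in> {..<r} \<rightarrow>\<^sub>E {..<r} \<and> (\<forall>s<r. f (h (i, s)) = h (fst (w i), snd (w i) s))"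
    by metis
  have "h (fst (w i), snd (w i) s) < h (fst (w j), snd (w j) t)"
    if "i \<in> I" "j \<in> I" "s < r" "t < r" "h (i, s) < h (j, t)" for i j s t
  proof -
    have "h (i, s) \<in> row_edge r h i" "h (j, t) \<in> row_edge r h j"
      using that(3,4) by (simp_all add: row_edge_def)
    hence "h (i, s) \<in> \<Union>A" "h (j, t) \<in> \<Union>A"
      using that(1,2) unfolding I_def by blast+
    hence "f (h (i, s)) < f (h (j, t))"
      using f(1) that(5) by (auto simp: strict_mono_on_def)
    thus ?thesis using w that by simp
  qed
  moreover have "I \<subseteq> {..<n}" by (auto simp: I_def)
  ultimately show ?thesis using card w by (intro exI[of _ I] exI[of _ w]) auto
qed

section \<open>The upper bound\<close>

lemma card_injections:
  fixes A :: "'a set" and B :: "'b set"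
  assumes "finite A" "finite B"
  shows "card {f \<in> A \<rightarrow>\<^sub>E B. inj_on f A} = (\<Prod>i<card A. card B - i)"
  using card_inj_on_subset_funcset[OF assms order_refl] by (simp add: atLeast0LessThan)

text \<open>Induction on \<open>h x\<close>. Elements with a smaller value are already fixed, and by
  injectivity of \<open>p\<close> nothing else is mapped to them, so \<open>p x\<close> is not below
  \<open>x\<close>. If \<open>p x\<close> were above \<open>x\<close>, then the preimage of
  \<open>x\<close> would be below \<open>x\<close> and hence fixed.\<close>

lemma permutes_order_preserving_imp_id:
  fixes h :: "'a \<Rightarrow> nat"
  assumes "p permutes X" "inj_on h X"
    and mono: "\<And>x y. \<lbrakk>x \<in> X; y \<in> X; h x < h y\<rbrakk> \<Longrightarrow> h (p x) < h (p y)"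
  shows "p = id"
proof -
  have mono': "h x < h y" if "x \<in> X" "y \<in> X" "h (p x) < h (p y)" for x y
    using mono[of y x] that \<open>inj_on h X\<close> by (metis inj_onD less_asym linorder_neqE_nat)
  have "p x = x" if "x \<in> X" for x
    using that
  proof (induction "h x" arbitrary: x rule: less_induct)
    case less
    have px: "p x \<in> X" using less.prems permutes_in_image[OF assms(1)] by blast
    obtain y where y: "y \<in> X" "p y = x"
      using less.prems assms(1) by (metis permutes_in_image permutes_surj surjD)
    consider "h (p x) < h x" | "h x < h (p x)" | "h (p x) = h x" by linarith
    thus ?case
    proof cases
      case 1
      hence "p (p x) = p x" using less.hyps[OF _ px] by simp
      thus ?thesis using permutes_inj[OF assms(1)] by (simp add: inj_eq)
    next
      case 2
      hence "h y < h x" using mono'[OF y(1) less.prems] y(2) by simp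
      thus ?thesis using less.hyps[OF _ y(1)] y(2) by simp
    next
      case 3
      thus ?thesis using assms(2) px less.prems by (simp add: inj_on_def)
    qed
  qed
  thus ?thesis using assms(1) by (auto simp: permutes_def fun_eq_iff)
qed

text \<open>The values of \<open>h\<close> outside \<open>X\<close> determine the order in which \<open>h\<close> must arrange \<open>X\<close>, so at most
  one of the \<open>(card X)!\<close> rearrangements of \<open>h\<close> along \<open>X\<close> belongs to the counted set.\<close>

lemma card_order_constrained_injections:
  fixes Y :: "'a set" and Z :: "nat set"
  assumes "finite Y" "finite Z" "X \<subseteq> Y" "g \<in> X \<rightarrow> Y - X"
  defines "L \<equiv> {h \<in> Y \<rightarrow>\<^sub>E Z. inj_on h Y}"
  shows "card {h \<in> L. \<forall>x\<in>X. \<forall>y\<in>X. h x < h y \<longrightarrow> h (g x) < h (g y)} * fact (card X) \<le> card L"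
proof -
  let ?E = "{h \<in> L. \<forall>x\<in>X. \<forall>y\<in>X. h x < h y \<longrightarrow> h (g x) < h (g y)}"
  let ?P = "{p. p permutes X}"
  have finX: "finite X" using assms finite_subset by blast
  have finL: "finite L"
    unfolding L_def by (rule finite_subset[of _ "Y \<rightarrow>\<^sub>E Z"]) (use assms in \<open>auto intro: finite_PiE\<close>)
  have eq: "p = q \<and> h = k"
    if p: "p permutes X" and q: "q permutes X" and h: "h \<in> ?E" and k: "k \<in> ?E"
      and hk: "h \<circ> p = k \<circ> q" for p q h k
  proof -
    define s where "s = q \<circ> inv p"
    have s: "s permutes X" unfolding s_def by (intro permutes_compose permutes_inv p q)
    have hs: "h x = k (s x)" for x
      using fun_cong[OF hk, of "inv p x"] permutes_inverses(1)[OF p] by (simp add: s_def)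
    have off: "h (g x) = k (g x)" if "x \<in> X" for x
      using hs[of "g x"] s that assms(4) by (auto simp: permutes_def)
    have ink: "inj_on k X" and inh: "inj_on h X"
      using h k assms(3) by (auto simp: L_def intro: inj_on_subset)
    \<comment> \<open>Since \<open>g\<close> maps \<open>X\<close> outside \<open>X\<close>, where
      \<open>s\<close> is the identity, \<open>h\<close> and \<open>k\<close> agree on the values of
      \<open>g\<close>. If \<open>s\<close> reversed a pair, the constraints on \<open>h\<close> and
      on \<open>k\<close> would order its image under \<open>g\<close> in opposite ways.\<close>
    have "k (s x) < k (s y)" if xy: "x \<in> X" "y \<in> X" "k x < k y" for x y
    proof (rule ccontr)
      assume "\<not> k (s x) < k (s y)"
      hence "h y < h x \<or> h x = h y" using hs by auto
      moreover have "x \<noteq> y" using xy by auto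
      ultimately have "h y < h x" using inh xy by (auto simp: inj_on_def)
      hence "h (g y) < h (g x)" "k (g x) < k (g y)" using h k xy by auto
      thus False using off xy by simp
    qed
    hence "s = id" by (rule permutes_order_preserving_imp_id[OF s ink])
    moreover have "s \<circ> p = q"
      using permutes_inv_o(2)[OF p] by (simp add: s_def comp_assoc)
    ultimately show ?thesis using hs by (simp add: fun_eq_iff)
  qed
  have "inj_on (\<lambda>(p, h). h \<circ> p) (?P \<times> ?E)"
    by (rule inj_onI) (use eq in \<open>auto split: prod.splits\<close>)
  moreover have "h \<circ> p \<in> L" if p: "p permutes X" and h: "h \<in> L" for p h
  proof -
    have pY: "p permutes Y" using permutes_subset[OF p assms(3)] .
    have "inj_on (h \<circ> p) Y"
      using h permutes_inj_on[OF pY] permutes_image[OF pY] by (auto simp: L_def intro!: comp_inj_on)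
    moreover have "h \<circ> p \<in> Y \<rightarrow>\<^sub>E Z"
      using h permutes_in_image[OF pY] permutes_not_in[OF pY] by (auto simp: L_def PiE_iff extensional_def)
    ultimately show ?thesis by (simp add: L_def)
  qed
  hence "(\<lambda>(p, h). h \<circ> p) ` (?P \<times> ?E) \<subseteq> L" by auto
  ultimately have "card (?P \<times> ?E) \<le> card L" using finL by (rule card_inj_on_le)
  thus ?thesis
    using card_permutations[OF refl finX] by (simp add: card_cartesian_product mult.commute)
qed

lemma card_labellings_pos: "0 < card (labellings r n)"
proof -
  have "card {f \<in> cells r n \<rightarrow>\<^sub>E {1..r * n}. inj_on f (cells r n)} > 0"
    by (subst card_injections) (auto intro!: prod_pos)
  thus ?thesis by (simp add: labellings_def)
qed

lemma finite_matching_of [simp]: "finite (matching_of r n h)"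
  by (simp add: matching_of_def)

text \<open>Union bound over the pairs \<open>(I, w)\<close> in \<open>S\<close>:
  \<open>n choose k\<close> sets of rows, and for each row one of \<open>n\<close> partner rows and
  one of \<open>r ^ r\<close> position maps. Each pair prescribes the order of \<open>r * k\<close>
  cells, which is satisfied by at most one labelling in \<open>fact (r * k)\<close>.\<close>

lemma card_labellings_large_twins:
  assumes "0 < r"
  shows "card {h \<in> labellings r n. k \<le> max_twins (matching_of r n h)} * fact (r * k)
       \<le> (n choose k) * (n * r ^ r) ^ k * card (labellings r n)"
proof -
  let ?L = "labellings r n"
  define W where "W = (\<lambda>I :: nat set. I \<rightarrow>\<^sub>E ({..<n} \<times> ({..<r} \<rightarrow>\<^sub>E {..<r})))"
  define E where "E = (\<lambda>(I, w). {h \<in> ?L. (\<forall>i\<in>I. fst (w i) \<notin> I) \<and>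
     (\<forall>i\<in>I. \<forall>j\<in>I. \<forall>s<r. \<forall>t<r. h (i, s) < h (j, t) \<longrightarrow>
        h (fst (w i), snd (w i) s) < h (fst (w j), snd (w j) t))})"
  define S where "S = (SIGMA I : {I. I \<subseteq> {..<n} \<and> card I = k}. W I)"
  have finI: "finite I" if "I \<subseteq> {..<n}" for I :: "nat set" using that finite_subset by blast
  have cW: "card (W I) = (n * r ^ r) ^ k" if "I \<subseteq> {..<n}" "card I = k" for I
    using that finI[of I] by (simp add: W_def card_funcsetE card_cartesian_product)
  have finW: "finite (W I)" if "I \<subseteq> {..<n}" for I
    using finI[OF that] by (auto simp: W_def intro!: finite_PiE)
  have finS: "finite S" unfolding S_def
    by (rule finite_SigmaI) (use finW in auto)
  have cS: "card S = (n choose k) * (n * r ^ r) ^ k"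
  proof -
    have "card S = (\<Sum>I | I \<subseteq> {..<n} \<and> card I = k. card (W I))"
      unfolding S_def by (rule card_SigmaI) (use finW in auto)
    also have "\<dots> = (\<Sum>I | I \<subseteq> {..<n} \<and> card I = k. (n * r ^ r) ^ k)"
      by (rule sum.cong) (use cW in auto)
    finally show ?thesis by (simp add: n_subsets)
  qed
  have cE: "card (E v) * fact (r * k) \<le> card ?L" if "v \<in> S" for v
  \<comment> \<open>\<open>S\<close> also contains pairs with a partner row inside \<open>I\<close>;
    they describe no twins, and \<open>E\<close> was defined to be empty for them.\<close>
  proof (cases "\<forall>i\<in>fst v. fst (snd v i) \<notin> fst v")
    case False
    hence "E v = {}" by (auto simp: E_def split: prod.splits)
    thus ?thesis by simp
  next
    case True
    obtain I w where v: "v = (I, w)" by (cases v)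
    have I: "I \<subseteq> {..<n}" "card I = k" and w: "w \<in> W I" using that v by (auto simp: S_def)
    define g where "g = (\<lambda>(i, s). (fst (w i), snd (w i) s))"
    let ?X = "I \<times> {..<r}"
    have wi: "fst (w i) < n" "snd (w i) \<in> {..<r} \<rightarrow>\<^sub>E {..<r}" if "i \<in> I" for i
    proof -
      have "w i \<in> {..<n} \<times> ({..<r} \<rightarrow>\<^sub>E {..<r})" using w that by (auto simp: W_def)
      thus "fst (w i) < n" "snd (w i) \<in> {..<r} \<rightarrow>\<^sub>E {..<r}" by (auto simp: mem_Times_iff)
    qed
    have "g \<in> ?X \<rightarrow> cells r n - ?X"
      using wi True v by (fastforce simp: g_def cells_def)
    moreover have "?X \<subseteq> cells r n" using I by (auto simp: cells_def)
    ultimately have "card {h \<in> ?L. \<forall>x\<in>?X. \<forall>y\<in>?X. h x < h y \<longrightarrow> h (g x) < h (g y)} *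
        fact (card ?X) \<le> card ?L"
      unfolding labellings_def by (intro card_order_constrained_injections) auto
    moreover have "E v = {h \<in> ?L. \<forall>x\<in>?X. \<forall>y\<in>?X. h x < h y \<longrightarrow> h (g x) < h (g y)}"
      using True v by (auto simp: E_def g_def)
    ultimately show ?thesis using I by (simp add: card_cartesian_product mult.commute)
  qed
  have "{h \<in> ?L. k \<le> max_twins (matching_of r n h)} \<subseteq> (\<Union>v\<in>S. E v)"
  proof clarify
    fix h assume h: "h \<in> ?L" "k \<le> max_twins (matching_of r n h)"
    have inj: "inj_on h (cells r n)" using h by (simp add: labellings_def)
    obtain A B where AB: "twins (matching_of r n h) A B" "k \<le> card A"
      using Max_in[OF twins_sizes[OF finite_matching_of, of r n h]] h(2)
      by (auto simp: max_twins_def)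
    obtain I w where I: "I \<subseteq> {..<n}" "card I = card A"
      and w: "\<forall>i\<in>I. fst (w i) \<in> {..<n} - I \<and> snd (w i) \<in> {..<r} \<rightarrow>\<^sub>E {..<r}"
      and ord: "\<forall>i\<in>I. \<forall>j\<in>I. \<forall>s<r. \<forall>t<r. h (i, s) < h (j, t) \<longrightarrow>
        h (fst (w i), snd (w i) s) < h (fst (w j), snd (w j) t)"
      using index_maps_of_twins[OF inj \<open>0 < r\<close> AB(1)] by blast
    \<comment> \<open>Larger twins are cut down to exactly \<open>k\<close> rows. Partners outside
      \<open>I\<close> remain outside \<open>J\<close>, and the order condition is
      inherited.\<close>
    obtain J where J: "J \<subseteq> I" "card J = k"
      using obtain_subset_with_card_n[of k I] AB(2) I(2) by auto
    have "(J, restrict w J) \<in> S"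
      using J I w by (fastforce simp: S_def W_def mem_Times_iff)
    moreover have "h \<in> E (J, restrict w J)"
      using h J w ord by (auto simp: E_def subset_iff)
    ultimately show "h \<in> (\<Union>v\<in>S. E v)" by blast
  qed
  moreover have "finite (\<Union>v\<in>S. E v)"
    using finS by (auto simp: E_def split: prod.splits)
  ultimately have "card {h \<in> ?L. k \<le> max_twins (matching_of r n h)} \<le> card (\<Union>v\<in>S. E v)"
    by (intro card_mono)
  also have "\<dots> \<le> (\<Sum>v\<in>S. card (E v))" using finS by (rule card_UN_le)
  finally have "card {h \<in> ?L. k \<le> max_twins (matching_of r n h)} * fact (r * k)
      \<le> (\<Sum>v\<in>S. card (E v) * fact (r * k))"
    by (simp flip: sum_distrib_right)
  also have "\<dots> \<le> (\<Sum>v\<in>S. card ?L)" by (intro sum_mono cE)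
  also have "\<dots> = (n choose k) * (n * r ^ r) ^ k * card ?L" by (simp add: cS)
  finally show ?thesis .
qed

section \<open>Estimating the union bound\<close>

text \<open>A single term of the exponential series is at most the whole series. With
  \<open>x = real k\<close> this is the weak Stirling bound
  \<open>fact k >= (k / e) ^ k\<close>.\<close>

lemma power_le_exp_mult_fact: "x ^ k \<le> exp x * fact k" if "0 \<le> x" for x :: real
proof -
  have "x ^ k / fact k = (\<Sum>i\<in>{k}. x ^ i / fact i)" by simp
  also have "\<dots> \<le> (\<Sum>i. x ^ i / fact i)"
    by (rule sum_le_suminf) (use summable_exp[of x] that in \<open>auto simp: field_simps\<close>)
  also have "\<dots> = exp x" by (simp add: exp_def field_simps)
  finally show ?thesis by (simp add: field_simps)
qed

text \<open>With \<open>n choose k <= n ^ k / fact k\<close> and the weak Stirling bounds for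
  \<open>fact k\<close> and \<open>fact (r * k)\<close>, the powers of \<open>r\<close> cancel and
  the union bound becomes \<open>((e / k) ^ (r + 1) * n ^ 2) ^ k\<close>. The hypothesis bounds the
  base by \<open>(1 / 2) ^ (r + 1)\<close>.\<close>

lemma prob_large_twins:
  assumes "0 < r" and k: "0 < k" "(2 * exp 1) ^ (r + 1) * real n ^ 2 \<le> real k ^ (r + 1)"
  shows "measure_pmf.prob (random_matching r n) {M. k \<le> max_twins M} \<le> (1 / 2) ^ k"
proof -
  let ?L = "card (labellings r n)"
  have Lpos: "real ?L > 0" using card_labellings_pos by simp
  define b where "b = real (card {h \<in> labellings r n. k \<le> max_twins (matching_of r n h)})"
  have f1: "real k ^ k \<le> exp 1 ^ k * fact k"
    using power_le_exp_mult_fact[of "real k" k] by (simp add: exp_of_nat_mult[symmetric])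
  have f2: "real (r * k) ^ (r * k) \<le> exp 1 ^ (r * k) * fact (r * k)"
    using power_le_exp_mult_fact[of "real (r * k)" "r * k"]
    by (simp add: exp_of_nat_mult[symmetric])
  have "real (card {h \<in> labellings r n. k \<le> max_twins (matching_of r n h)} * fact (r * k))
      \<le> real ((n choose k) * (n * r ^ r) ^ k * ?L)"
    using card_labellings_large_twins[OF assms(1)] by (simp only: of_nat_le_iff)
  hence "b * fact (r * k) \<le> real (n choose k) * (real n * real r ^ r) ^ k * ?L"
    by (simp add: b_def)
  hence "b * fact (r * k) * fact k \<le> real (n choose k) * (real n * real r ^ r) ^ k * ?L * fact k"
    by (rule mult_right_mono) simp
  also have "\<dots> = real ((n choose k) * fact k) * (real n * real r ^ r) ^ k * ?L"
    by simp
  also have "\<dots> \<le> real (n ^ k) * (real n * real r ^ r) ^ k * ?L"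
    by (intro mult_right_mono) (use binomial_fact_pow[of n k] in \<open>simp_all only: of_nat_le_iff, auto\<close>)
  also have "\<dots> = (real n ^ 2 * real r ^ r) ^ k * ?L"
    by (simp add: power_mult_distrib power2_eq_square)
  finally have 1: "b * (fact (r * k) * fact k) \<le> (real n ^ 2 * real r ^ r) ^ k * ?L"
    by (simp add: mult.assoc)
  have bnn: "0 \<le> b" by (simp add: b_def)
  \<comment> \<open>The factor \<open>(real n ^ 2 * real r ^ r) ^ k\<close> is kept on both sides,
    so that after inserting the hypothesis on \<open>k\<close> and the bounds \<open>f1\<close>,
    \<open>f2\<close> it can be cancelled against the one in \<open>1\<close>.\<close>
  have "b * (2 ^ (r + 1) * real n ^ 2 * real r ^ r) ^ k
      = b * (((2 * exp 1) ^ (r + 1) * real n ^ 2) ^ k * (real r ^ r) ^ k) / exp 1 ^ (k * (r + 1))"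
  proof -
    have "(((2 * exp 1) ^ (r + 1) * real n ^ 2) ^ k * (real r ^ r) ^ k)
        = exp 1 ^ (k * (r + 1)) * (2 ^ (r + 1) * real n ^ 2 * real r ^ r) ^ k"
      by (simp only: power_mult_distrib power_mult[symmetric] mult_ac)
    thus ?thesis by simp
  qed
  also have "\<dots> \<le> b * ((real k ^ (r + 1)) ^ k * (real r ^ r) ^ k) / exp 1 ^ (k * (r + 1))"
    by (intro divide_right_mono mult_left_mono mult_right_mono power_mono k(2) bnn) auto
  also have "(real k ^ (r + 1)) ^ k * (real r ^ r) ^ k = real (r * k) ^ (r * k) * real k ^ k"
    by (simp add: power_mult_distrib mult_ac power_mult[symmetric] power_add[symmetric])
  also have "b * \<dots> / exp 1 ^ (k * (r + 1))
     \<le> b * ((exp 1 ^ (r * k) * fact (r * k)) * (exp 1 ^ k * fact k)) / exp 1 ^ (k * (r + 1))"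
    by (intro divide_right_mono mult_left_mono mult_mono f1 f2 bnn) auto
  also have "\<dots> = b * (fact (r * k) * fact k)"
    by (simp add: power_add mult_ac)
  also note 1
  finally have 2: "b * (2 ^ (r + 1)) ^ k * (real n ^ 2 * real r ^ r) ^ k
      \<le> ?L * (real n ^ 2 * real r ^ r) ^ k"
    by (simp add: power_mult_distrib mult_ac)
  have "b * 2 ^ k \<le> ?L"
  \<comment> \<open>For \<open>n = 0\<close> the common factor is zero and cannot be cancelled; then
    all twins are empty, and \<open>b = 0\<close> because \<open>k\<close> is positive.\<close>
  proof (cases "n = 0")
    case True
    have "b = 0" unfolding b_def
    proof -
      have "max_twins (matching_of r n h) = 0" for h
      proof -
        have "{card A |A B. twins (matching_of r n h) A B} = {0}"
          using twins_sizes(2)[of "matching_of r n h"] True by (auto simp: matching_of_def twins_def)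
        thus ?thesis by (simp add: max_twins_def)
      qed
      thus "real (card {h \<in> labellings r n. k \<le> max_twins (matching_of r n h)}) = 0"
        using k(1) by simp
    qed
    thus ?thesis by simp
  next
    case False
    hence "b * (2 ^ (r + 1)) ^ k \<le> ?L" using 2 \<open>0 < r\<close> by simp
    moreover have "b * 2 ^ k \<le> b * (2 ^ (r + 1)) ^ k"
      by (intro mult_left_mono power_mono bnn) auto
    ultimately show ?thesis by simp
  qed
  hence "b / ?L \<le> (1 / 2) ^ k" using Lpos by (simp add: field_simps power_divide)
  thus ?thesis using prob_random_matching[OF assms(1)] by (simp add: b_def)
qed

section \<open>Sequences without repetitions\<close>

text \<open>The letters of \<open>S\<close> may occur at most once, the others freely, so the
  exponential generating function by length is
  \<open>(1 + x) ^ card S * exp (x * (card T - card S))\<close>. The bound says that a coefficient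
  times \<open>x ^ card I\<close> is at most the value at \<open>x\<close>. The induction adds one
  letter to \<open>S\<close> at a time.\<close>

lemma card_sequences_without_repeats:
  fixes x :: real
  assumes "finite S" "S \<subseteq> T" "finite T" "finite I" "0 < x"
  shows "real (card {g \<in> I \<rightarrow>\<^sub>E T. \<forall>i\<in>I. \<forall>j\<in>I. g i = g j \<longrightarrow> g i \<in> S \<longrightarrow> i = j})
    \<le> fact (card I) / x ^ card I * (1 + x) ^ card S * exp (x * (real (card T) - real (card S)))"
  using assms(1-4)
proof (induction S arbitrary: I T rule: finite_induct)
  case empty
  have "(x * real (card T)) ^ card I \<le> exp (x * real (card T)) * fact (card I)"
    by (rule power_le_exp_mult_fact) (use \<open>0 < x\<close> in simp)
  thus ?case using \<open>0 < x\<close> empty by (simp add: card_funcsetE field_simps)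
next
  case (insert s S)
  define N where "N = (\<lambda>I (T :: 'a set) S. {g \<in> I \<rightarrow>\<^sub>E T. \<forall>i\<in>I. \<forall>j\<in>I. g i = g j \<longrightarrow> g i \<in> S \<longrightarrow> i = (j :: 'b)})"
  let ?T = "T - {s}"
  define C where "C = (1 + x) ^ card S * exp (x * (real (card T) - real (card (insert s S))))"
  have T: "S \<subseteq> ?T" "finite ?T" using insert by auto
  have cT: "real (card ?T) - real (card S) = real (card T) - real (card (insert s S))"
  proof -
    have "Suc (card ?T) = card T" using card_Suc_Diff1[of T s] insert.prems by simp
    thus ?thesis using insert by (simp flip: of_nat_Suc)
  qed
  have IH: "real (card (N J ?T S)) \<le> fact (card J) / x ^ card J * C" if "finite J" for J
    using insert.IH[OF T that] by (simp add: N_def C_def cT mult.assoc)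
  have finN: "finite (N J ?T S)" if "finite J" for J
    unfolding N_def by (rule finite_subset[of _ "J \<rightarrow>\<^sub>E ?T"])
      (use T(2) that in \<open>auto intro!: finite_PiE\<close>)
  \<comment> \<open>Either \<open>s\<close> does not occur, or it occurs at exactly one index
    \<open>i\<close>, and deleting that index leaves a sequence without \<open>s\<close>.\<close>
  have sub: "N I T (insert s S) \<subseteq> N I ?T S \<union> (\<Union>i\<in>I. (\<lambda>g. g(i := s)) ` N (I - {i}) ?T S)"
  proof
    fix g assume g: "g \<in> N I T (insert s S)"
    hence gP: "g \<in> I \<rightarrow>\<^sub>E T"
      and uniq: "\<And>i j. \<lbrakk>i \<in> I; j \<in> I; g i = g j; g i \<in> insert s S\<rbrakk> \<Longrightarrow> i = j"
      unfolding N_def by blast+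
    show "g \<in> N I ?T S \<union> (\<Union>i\<in>I. (\<lambda>g. g(i := s)) ` N (I - {i}) ?T S)"
    proof (cases "s \<in> g ` I")
      case False
      hence "g \<in> I \<rightarrow>\<^sub>E ?T" using gP by (auto simp: PiE_iff)
      thus ?thesis using uniq by (auto simp: N_def)
    next
      case True
      then obtain i where i: "i \<in> I" "g i = s" by auto
      define f where "f = g(i := undefined)"
      have "f \<in> (I - {i}) \<rightarrow>\<^sub>E ?T"
      proof (rule PiE_I)
        fix j assume j: "j \<in> I - {i}"
        hence "g j \<noteq> s" using uniq[of i j] i by auto
        thus "f j \<in> ?T" using PiE_mem[OF gP, of j] j by (simp add: f_def)
      next
        fix j assume "j \<notin> I - {i}"
        thus "f j = undefined" using PiE_arb[OF gP, of j] by (auto simp: f_def)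
      qed
      moreover have "\<forall>a\<in>I - {i}. \<forall>b\<in>I - {i}. f a = f b \<longrightarrow> f a \<in> S \<longrightarrow> a = b"
        using uniq by (simp add: f_def)
      ultimately have "f \<in> N (I - {i}) ?T S" unfolding N_def by blast
      moreover have "g = f(i := s)" using fun_upd_triv[of g i] i(2) by (simp add: f_def)
      ultimately show ?thesis using i(1) by blast
    qed
  qed
  have "card (N I T (insert s S)) \<le> card (N I ?T S \<union> (\<Union>i\<in>I. (\<lambda>g. g(i := s)) ` N (I - {i}) ?T S))"
    by (rule card_mono[OF _ sub]) (use finN insert in auto)
  also have "\<dots> \<le> card (N I ?T S) + card (\<Union>i\<in>I. (\<lambda>g. g(i := s)) ` N (I - {i}) ?T S)"
    by (rule card_Un_le)
  also have "\<dots> \<le> card (N I ?T S) + (\<Sum>i\<in>I. card ((\<lambda>g. g(i := s)) ` N (I - {i}) ?T S))"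
    by (intro add_left_mono card_UN_le insert)
  also have "\<dots> \<le> card (N I ?T S) + (\<Sum>i\<in>I. card (N (I - {i}) ?T S))"
    by (intro add_left_mono sum_mono card_image_le finN) (use insert in auto)
  finally have "real (card (N I T (insert s S)))
      \<le> real (card (N I ?T S) + (\<Sum>i\<in>I. card (N (I - {i}) ?T S)))"
    by (simp only: of_nat_le_iff)
  also have "\<dots> = real (card (N I ?T S)) + (\<Sum>i\<in>I. real (card (N (I - {i}) ?T S)))" by simp
  also have "\<dots> \<le> fact (card I) / x ^ card I * C
      + (\<Sum>i\<in>I. fact (card I - 1) / x ^ (card I - 1) * C)"
  proof (intro add_mono sum_mono)
    fix i assume "i \<in> I"
    thus "real (card (N (I - {i}) ?T S)) \<le> fact (card I - 1) / x ^ (card I - 1) * C"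
      using IH[of "I - {i}"] insert by (simp add: card_Diff_singleton)
  qed (use IH insert in simp)
  \<comment> \<open>The \<open>card I\<close> equal summands add up to \<open>x\<close> times the
    first term, which gives the new factor \<open>1 + x\<close>. If \<open>I\<close> is empty, the
    sum vanishes.\<close>
  also have "\<dots> \<le> fact (card I) / x ^ card I * C * (1 + x)"
  proof (cases "card I")
    case 0
    have "0 \<le> C * x" using \<open>0 < x\<close> by (simp add: C_def)
    thus ?thesis using 0 by (simp add: algebra_simps)
  next
    case (Suc m)
    thus ?thesis using \<open>0 < x\<close> by (simp add: field_simps)
  qed
  also have "\<dots> = fact (card I) / x ^ card I * (1 + x) ^ card (insert s S)
      * exp (x * (real (card T) - real (card (insert s S))))"
    using insert by (simp add: C_def)
  finally show ?case by (simp add: N_def)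
qed

text \<open>Stirling's upper bound up to a linear factor. The induction step rests on
  \<open>(1 - 1 / (n + 1)) ^ (n + 1) <= exp (-1)\<close>.\<close>

lemma fact_times_exp_le: "fact n * exp (real n) \<le> exp 1 * real n * real n ^ n" if "0 < n"
  using that
proof (induction n rule: nat_induct_non_zero)
  case (Suc n)
  have "1 + - (1 / real (Suc n)) \<le> exp (- (1 / real (Suc n)))" by (rule exp_ge_add_one_self)
  hence "(real n / real (Suc n)) ^ Suc n \<le> exp (- (1 / real (Suc n))) ^ Suc n"
    by (intro power_mono) (simp_all add: field_simps)
also have "\<dots> = exp (real (Suc n) * - (1 / real (Suc n)))" by (rule exp_of_nat_mult[symmetric])
  also have "\<dots> = exp (-1)" by simp
  finally have "real n ^ Suc n / real (Suc n) ^ Suc n \<le> 1 / exp 1"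
    by (simp only: power_divide exp_minus inverse_eq_divide)
  hence "real n ^ Suc n * exp 1 \<le> real (Suc n) ^ Suc n"
    by (simp only: divide_le_eq le_divide_eq exp_gt_zero zero_less_power of_nat_0_less_iff
        zero_less_Suc if_True times_divide_eq_left mult_1)
  hence e: "exp 1 * real n * real n ^ n \<le> real (Suc n) ^ Suc n" by (simp add: mult_ac)
  have "fact (Suc n) * exp (real (Suc n)) = real (Suc n) * exp 1 * (fact n * exp (real n))"
    by (simp add: exp_add algebra_simps)
  also have "\<dots> \<le> real (Suc n) * exp 1 * (exp 1 * real n * real n ^ n)"
    by (intro mult_left_mono Suc.IH) auto
  also have "\<dots> \<le> real (Suc n) * exp 1 * real (Suc n) ^ Suc n"
    by (intro mult_left_mono e) auto
  finally show ?case by (simp add: mult_ac)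
qed simp

text \<open>The quadratic gain over \<open>1 + x <= exp x\<close> is the source of the birthday
  exponent. With \<open>c = 1 / 5\<close>, the coefficients \<open>1 / 2 - c\<close>,
  \<open>- c\<close> and \<open>- c / 2\<close> of \<open>x ^ 2\<close>, \<open>x ^ 3\<close> and
  \<open>x ^ 4\<close> in the product below sum to zero, which suffices for
  \<open>x <= 1\<close>.\<close>

lemma one_plus_le_exp_quadratic: "1 + x \<le> exp (x - x\<^sup>2 / 5)" if "0 \<le> x" "x \<le> 1" for x :: real
proof -
  have x: "x ^ 3 \<le> x\<^sup>2" "x ^ 4 \<le> x\<^sup>2" "x\<^sup>2 \<le> 1"
    using that by (auto intro: power_decreasing power_le_one)
  have "1 + x \<le> (1 + x + x\<^sup>2 / 2) * (1 - x\<^sup>2 / 5)"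
    using x(1,2) by (simp add: algebra_simps power2_eq_square eval_nat_numeral)
  also have "\<dots> \<le> exp x * exp (- (x\<^sup>2 / 5))"
    using exp_lower_Taylor_quadratic[OF that(1)] exp_ge_add_one_self[of "- (x\<^sup>2 / 5)"] x(3)
    by (intro mult_mono) simp_all
  also have "\<dots> = exp (x - x\<^sup>2 / 5)" by (simp flip: exp_add)
  finally show ?thesis .
qed

text \<open>Birthday bound, obtained at \<open>x = card I / card T\<close>. There the linear
  exponents add up to \<open>card I\<close>, and Stirling's bound turns the prefactor into the
  number of all sequences times a linear factor. What remains is the saving
  \<open>exp (- card S * x ^ 2 / 5)\<close>.\<close>

lemma card_sequences_without_repeats_le_exp:
  assumes "S \<subseteq> T" "finite T" "finite I" "0 < card I" "card I \<le> card T"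
  shows "real (card {g \<in> I \<rightarrow>\<^sub>E T. \<forall>i\<in>I. \<forall>j\<in>I. g i = g j \<longrightarrow> g i \<in> S \<longrightarrow> i = j})
    \<le> real (card T) ^ card I *
      (exp 1 * card I * exp (- (real (card S) * (real (card I))\<^sup>2 / (5 * (real (card T))\<^sup>2))))"
proof -
  let ?n = "real (card I)" and ?t = "real (card T)" and ?s = "real (card S)"
  define x where "x = ?n / ?t"
  have pos: "0 < ?n" "0 < ?t" using assms by auto
  have x: "0 < x" "x \<le> 1" using assms(5) pos by (auto simp: x_def)
  have "(1 + x) ^ card S \<le> exp (x - x\<^sup>2 / 5) ^ card S"
    using x by (intro power_mono one_plus_le_exp_quadratic) auto
  also have "\<dots> = exp (?s * (x - x\<^sup>2 / 5))" by (simp add: exp_of_nat_mult)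
  finally have p: "(1 + x) ^ card S \<le> exp (?s * (x - x\<^sup>2 / 5))" .
  have f: "fact (card I) * exp ?n / ?n ^ card I \<le> exp 1 * ?n"
    using fact_times_exp_le[of "card I"] pos by (simp add: field_simps)
  have "finite S" using assms finite_subset by blast
  hence "real (card {g \<in> I \<rightarrow>\<^sub>E T. \<forall>i\<in>I. \<forall>j\<in>I. g i = g j \<longrightarrow> g i \<in> S \<longrightarrow> i = j})
     \<le> fact (card I) / x ^ card I * (1 + x) ^ card S * exp (x * (?t - ?s))"
    using assms x by (intro card_sequences_without_repeats) auto
  also have "\<dots> \<le> fact (card I) / x ^ card I * exp (?s * (x - x\<^sup>2 / 5)) * exp (x * (?t - ?s))"
    using x by (intro mult_right_mono mult_left_mono p) auto
  also have "\<dots> = fact (card I) / x ^ card I * exp (?s * (x - x\<^sup>2 / 5) + x * (?t - ?s))"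
    by (simp add: exp_add)
  also have "?s * (x - x\<^sup>2 / 5) + x * (?t - ?s) = ?n + - (?s * x\<^sup>2 / 5)"
  proof -
    have "x * ?t = ?n" using pos by (simp add: x_def)
    thus ?thesis by (simp add: algebra_simps)
  qed
  also have "fact (card I) / x ^ card I * exp (?n + - (?s * x\<^sup>2 / 5))
      = ?t ^ card I * ((fact (card I) * exp ?n / ?n ^ card I) * exp (- (?s * x\<^sup>2 / 5)))"
    unfolding exp_add using pos by (simp add: x_def power_divide)
  also have "\<dots> \<le> ?t ^ card I * ((exp 1 * ?n) * exp (- (?s * x\<^sup>2 / 5)))"
    by (intro mult_left_mono mult_right_mono f) auto
  also have "?s * x\<^sup>2 / 5 = ?s * ?n\<^sup>2 / (5 * ?t\<^sup>2)"
    by (simp add: x_def power_divide)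
  finally show ?thesis .
qed

section \<open>Replacing labellings by maps with independent values\<close>

text \<open>An injective map into \<open>{..<N}\<close> amounts to its image \<open>V\<close> together with a labelling. This
  trades labellings for maps with almost independent values.\<close>

lemma card_labellings_le_card_maps:
  assumes PQ: "\<And>h e. \<lbrakk>h \<in> labellings r n; P h; strict_mono_on {1..r * n} e\<rbrakk>
      \<Longrightarrow> Q (restrict (e \<circ> h) (cells r n))"
  shows "(N choose (r * n)) * card {h \<in> labellings r n. P h}
       \<le> card {F \<in> cells r n \<rightarrow>\<^sub>E {..<N :: nat}. Q F}"
proof -
  let ?K = "r * n" and ?X = "cells r n"
  let ?V = "{V. V \<subseteq> {..<N} \<and> card V = ?K}" and ?H = "{h \<in> labellings r n. P h}"
  have "\<exists>e. strict_mono_on {1..?K} e \<and> bij_betw e {1..?K} V" if "V \<in> ?V" for V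
  proof -
    have "finite V" using that finite_subset by blast
    then obtain d where "bij_betw d {..<card V} V" "strict_mono_on {..<card V} d"
      by (rule ex_bij_betw_strict_mono_card)
    hence d: "bij_betw d {..<?K} V" "strict_mono_on {..<?K} d" using that by simp_all
    have "bij_betw (\<lambda>x. x - 1) {1..?K} {..<?K}"
      by (rule bij_betw_byWitness[of _ Suc]) auto
    hence "bij_betw (d \<circ> (\<lambda>x. x - 1)) {1..?K} V" using d(1) by (rule bij_betw_trans)
    moreover have "strict_mono_on {1..?K} (d \<circ> (\<lambda>x. x - 1))"
      by (rule strict_mono_onI) (auto intro!: strict_mono_onD[OF d(2)])
    ultimately show ?thesis by blast
  qed
  hence "\<forall>V\<in>?V. \<exists>e. strict_mono_on {1..?K} e \<and> bij_betw e {1..?K} V" by blast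
  from bchoice[OF this] obtain e where e: "\<And>V. V \<in> ?V \<Longrightarrow> strict_mono_on {1..?K} (e V)"
    "\<And>V. V \<in> ?V \<Longrightarrow> bij_betw (e V) {1..?K} V" by blast
  define c where "c = (\<lambda>(V, h). restrict (e V \<circ> h) ?X)"
  have c_bij: "bij_betw (c (V, h)) ?X V" if "V \<in> ?V" "h \<in> ?H" for V h
  proof -
    have "bij_betw (e V \<circ> h) ?X V"
      by (rule bij_betw_trans[OF labellings_bij e(2)]) (use that in auto)
    thus ?thesis unfolding c_def by (simp cong: bij_betw_cong)
  qed
  have "inj_on c (?V \<times> ?H)"
  proof (rule inj_onI, clarify)
    fix V h V' h'
    assume *: "V \<subseteq> {..<N}" "card V = ?K" "V' \<subseteq> {..<N}" "card V' = ?K"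
      "h \<in> labellings r n" "P h" "h' \<in> labellings r n" "P h'" "c (V, h) = c (V', h')"
    have "V = V'" using c_bij[of V h] c_bij[of V' h'] * by (simp add: bij_betw_def)
    moreover have "h x = h' x" if "x \<in> ?X" for x
    proof -
      have "e V (h x) = e V (h' x)"
        using fun_cong[OF *(9), of x] that \<open>V = V'\<close> by (simp add: c_def)
      moreover have "inj_on (e V) {1..?K}" using e(2)[of V] * by (simp add: bij_betw_def)
      ultimately show ?thesis
        using bij_betw_apply[OF labellings_bij[OF *(5)] that]
          bij_betw_apply[OF labellings_bij[OF *(7)] that] by (meson inj_onD)
    qed
    hence "h = h'" using *(5,7) unfolding labellings_def by (blast intro: PiE_ext)
    ultimately show "V = V' \<and> h = h'" by simp
  qed
  moreover have "c ` (?V \<times> ?H) \<subseteq> {F \<in> ?X \<rightarrow>\<^sub>E {..<N}. Q F}"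
  proof clarify
    fix V h assume *: "V \<subseteq> {..<N}" "card V = ?K" "h \<in> labellings r n" "P h"
    have "Q (c (V, h))" using PQ[OF *(3,4) e(1)] * by (simp add: c_def)
    moreover have "c (V, h) x \<in> {..<N}" if "x \<in> ?X" for x
      using bij_betw_apply[OF c_bij[of V h] that] * by blast
    hence "c (V, h) \<in> ?X \<rightarrow>\<^sub>E {..<N}" by (intro PiE_I) (auto simp: c_def)
    ultimately show "c (V, h) \<in> ?X \<rightarrow>\<^sub>E {..<N} \<and> Q (c (V, h))" by simp
  qed
  moreover have "finite {F \<in> ?X \<rightarrow>\<^sub>E {..<N}. Q F}"
    by (rule finite_subset[of _ "?X \<rightarrow>\<^sub>E {..<N}"]) (auto intro: finite_PiE)
  ultimately have "card (?V \<times> ?H) \<le> card {F \<in> ?X \<rightarrow>\<^sub>E {..<N}. Q F}" by (rule card_inj_on_le)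
  thus ?thesis by (simp add: card_cartesian_product n_subsets)
qed

text \<open>With \<open>K = r * n\<close>, the product on the right counts the injections of
  \<open>K\<close> cells into \<open>N\<close> values. By Bernoulli's inequality they form a
  fraction of at least \<open>(1 - K / N) ^ K >= 1 - K ^ 2 / N >= 1 / 2\<close> of all maps.\<close>

lemma power_le_binomial_mult_card_labellings:
  assumes "2 * (r * n)\<^sup>2 \<le> N" "0 < r * n"
  shows "real N ^ (r * n) \<le> 2 * (real (N choose (r * n)) * real (card (labellings r n)))"
proof -
  define K where "K = r * n"
  have "K \<le> 2 * K\<^sup>2" by (simp add: power2_eq_square)
  hence KN: "K \<le> N" "2 * K\<^sup>2 \<le> N" "0 < N"
    using assms unfolding K_def by linarith+
  have L: "real (card (labellings r n)) = (\<Prod>i<K. real (K - i))"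
    unfolding labellings_def by (subst card_injections) (simp_all add: K_def)
  have "real N ^ K * (1 / 2) \<le> real N ^ K * (1 + real K * (- real K / real N))"
  proof (rule mult_left_mono)
    have "2 * (real K)\<^sup>2 \<le> real N" using KN(2) by (metis of_nat_le_iff of_nat_mult of_nat_numeral of_nat_power)
    thus "1 / 2 \<le> 1 + real K * (- real K / real N)"
      using KN by (simp add: field_simps power2_eq_square)
  qed simp
  also have "\<dots> \<le> real N ^ K * (1 + - real K / real N) ^ K"
    using KN by (intro mult_left_mono Bernoulli_inequality) (auto simp: field_simps)
  also have "\<dots> = (\<Prod>i<K. real (N - K))"
    using KN by (simp add: power_mult_distrib[symmetric] field_simps of_nat_diff)
  also have "\<dots> \<le> (\<Prod>i<K. real (N - i))" by (rule prod_mono) auto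
  also have "\<dots> = (\<Prod>i<K. real (N - i) / real (K - i)) * (\<Prod>i<K. real (K - i))"
    by (simp flip: prod.distrib)
  also have "\<dots> = real (N choose K) * real (card (labellings r n))"
    using binomial_altdef_of_nat[OF KN(1), where 'a = real] by (simp add: L atLeast0LessThan)
  finally show ?thesis by (simp add: K_def)
qed

section \<open>The lower bound\<close>

definition block_tuple :: "nat \<Rightarrow> nat \<Rightarrow> (nat \<times> nat \<Rightarrow> nat) \<Rightarrow> nat \<Rightarrow> nat \<Rightarrow> nat" where
  "block_tuple r q F i = (\<lambda>s\<in>{..<r}. F (i, s) div q)"

text \<open>Two edges with the same tuple of distinct blocks are candidates for corresponding edges of
  twins, and candidates using disjoint sets of blocks can be combined. The set \<open>E\<close> consists of the
  blocks not used by a maximal family of such candidates.\<close>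

lemma ex_blocks_without_repeats:
  assumes "0 < r" and h: "h \<in> labellings r n" and e: "strict_mono_on {1..r * n} e"
    and small: "max_twins (matching_of r n h) < k"
    and F: "\<And>i s. \<lbrakk>i < n; s < r\<rbrakk> \<Longrightarrow> F (i, s) = e (h (i, s))"
  shows "\<exists>E\<subseteq>{..<m}. m \<le> card E + r * (k - 1) \<and>
    (\<forall>i<n. \<forall>j<n. block_tuple r q F i = block_tuple r q F j \<longrightarrow> inj_on (block_tuple r q F i) {..<r} \<longrightarrow>
       block_tuple r q F i ` {..<r} \<subseteq> E \<longrightarrow> i = j)"
proof -
  define g where "g = block_tuple r q F"
  let ?R = "{..<r}"
  have R: "{..<r} \<noteq> {}" using \<open>0 < r\<close> by auto
  have inj: "inj_on h (cells r n)" using h by (simp add: labellings_def)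
  have g: "g i s = e (h (i, s)) div q" if "i < n" "s < r" for i s
    using that F by (simp add: g_def block_tuple_def)
  have h_in: "h (i, s) \<in> {1..r * n}" if "i < n" "s < r" for i s
    using bij_betw_apply[OF labellings_bij[OF h], of "(i, s)"] that by (simp add: cells_def)
  \<comment> \<open>Only one row of each pair is stored; a partner with the same tuple is merely
    required to exist.\<close>
  define Fam where "Fam = {J. J \<subseteq> {..<n} \<and> (\<forall>i\<in>J. inj_on (g i) ?R \<and> (\<exists>j<n. j \<noteq> i \<and> g j = g i)) \<and>
     (\<forall>i\<in>J. \<forall>j\<in>J. i \<noteq> j \<longrightarrow> g i ` ?R \<inter> g j ` ?R = {})}"
  have Fam_small: "card J < k" if "J \<in> Fam" for J
  proof -
    have J: "J \<subseteq> {..<n}" "\<And>i. i \<in> J \<Longrightarrow> inj_on (g i) ?R" "\<forall>i\<in>J. \<exists>j<n. j \<noteq> i \<and> g j = g i"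
      "\<And>i j. \<lbrakk>i \<in> J; j \<in> J; i \<noteq> j\<rbrakk> \<Longrightarrow> g i ` ?R \<inter> g j ` ?R = {}"
      using that unfolding Fam_def by blast+
    from bchoice[OF J(3)] obtain p
      where p: "\<And>i. i \<in> J \<Longrightarrow> p i < n" "\<And>i. i \<in> J \<Longrightarrow> p i \<noteq> i" "\<And>i. i \<in> J \<Longrightarrow> g (p i) = g i"
      by blast
    \<comment> \<open>Distinct rows of \<open>J\<close> use disjoint nonempty sets of blocks, so
      their tuples differ. This makes the choice of partners injective and keeps the partners
      outside \<open>J\<close>.\<close>
    have same: "i = j" if "i \<in> J" "j \<in> J" "g i = g j" for i j
    proof (rule ccontr)
      assume "i \<noteq> j"
      hence "g j ` ?R = {}" using J(4)[OF that(1,2)] that(3) by simp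
      thus False using R by simp
    qed
    have "\<exists>A B. twins (matching_of r n h) A B \<and> card A = card J"
    proof (rule ex_twins_of_labelling[OF inj \<open>0 < r\<close> J(1), of p])
      show "inj_on p J"
      proof (rule inj_onI)
        fix i j assume "i \<in> J" "j \<in> J" "p i = p j"
        thus "i = j" using p(3)[of i] p(3)[of j] by (intro same) simp_all
      qed
      show "p ` J \<subseteq> {..<n}" using p(1) by blast
      have "p i \<notin> J" if "i \<in> J" for i using same[of "p i" i] p(2,3)[of i] that by blast
      thus "p ` J \<inter> J = {}" by blast
    next
      fix i j s t assume *: "i \<in> J" "j \<in> J" "s < r" "t < r" "h (i, s) < h (j, t)"
      have n: "i < n" "j < n" using J(1) * by auto
      have "e (h (i, s)) < e (h (j, t))"
        using strict_mono_onD[OF e h_in[OF n(1) *(3)] h_in[OF n(2) *(4)] *(5)] .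
      hence "g i s \<le> g j t" using n * by (simp add: g div_le_mono)
      \<comment> \<open>All blocks used by \<open>J\<close> are distinct: across rows by
        disjointness, within a row by injectivity. So the order of two cells is the strict order of
        their blocks, and the partner cells lie in the same blocks.\<close>
      moreover have "g i s \<noteq> g j t"
      proof
        assume eq: "g i s = g j t"
        have "i = j"
        proof (rule ccontr)
          assume "i \<noteq> j"
          hence "g i ` ?R \<inter> g j ` ?R = {}" by (rule J(4)[OF *(1,2)])
          moreover have "g i s \<in> g i ` ?R" using *(3) by blast
          moreover have "g i s \<in> g j ` ?R" unfolding eq using *(4) by blast
          ultimately show False by blast
        qed
        moreover have "s = t"
          using inj_onD[OF J(2)[OF *(1)], of s t] eq * \<open>i = j\<close> by simp
        ultimately show False using *(5) by simp
      qed
      ultimately have "g (p i) s < g (p j) t" using p(3) * by simp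
      hence "e (h (p i, s)) < e (h (p j, t))"
        using g[OF p(1)[OF *(1)] *(3)] g[OF p(1)[OF *(2)] *(4)]
        by (metis div_le_mono linorder_not_less)
      thus "h (p i, s) < h (p j, t)"
        using strict_mono_on_less[OF e h_in[OF p(1)[OF *(1)] *(3)] h_in[OF p(1)[OF *(2)] *(4)]]
        by simp
    qed
    then obtain A B where "twins (matching_of r n h) A B" "card A = card J" by blast
    hence "card J \<in> {card A | A B. twins (matching_of r n h) A B}" by force
    hence "card J \<le> max_twins (matching_of r n h)"
      unfolding max_twins_def by (rule Max_ge[OF twins_sizes(1)[OF finite_matching_of]])
    thus ?thesis using small by simp
  qed
  have "Fam \<subseteq> Pow {..<n}" unfolding Fam_def by blast
  hence "finite Fam" by (rule finite_subset) simp
  moreover have "{} \<in> Fam" by (simp add: Fam_def)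
  ultimately obtain J where J: "J \<in> Fam" and max: "\<And>J'. J' \<in> Fam \<Longrightarrow> J \<subseteq> J' \<Longrightarrow> J = J'"
    using finite_has_maximal[of Fam] by blast
  define D where "D = (\<Union>i\<in>J. g i ` ?R)"
  have "finite J" using J finite_subset[of J "{..<n}"] by (auto simp: Fam_def)
  have "card D \<le> (\<Sum>i\<in>J. card (g i ` ?R))" unfolding D_def using \<open>finite J\<close> by (rule card_UN_le)
  also have "\<dots> \<le> (\<Sum>i\<in>J. r)" by (intro sum_mono) (metis card_image_le card_lessThan finite_lessThan)
  also have "\<dots> \<le> r * (k - 1)"
  proof -
    have "card J \<le> k - 1" using Fam_small[OF J] by linarith
    thus ?thesis by simp
  qed
  finally have cD: "card D \<le> r * (k - 1)" .
  have "finite D" using \<open>finite J\<close> by (simp add: D_def)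
  hence "card {..<m} - card D \<le> card ({..<m} - D)" by (rule diff_card_le_card_Diff)
  hence "m \<le> card ({..<m} - D) + r * (k - 1)" using cD by simp
  moreover have "i = j"
    if ij: "i < n" "j < n" "g i = g j" "inj_on (g i) ?R" "g i ` ?R \<subseteq> {..<m} - D" for i j
  proof (rule ccontr)
    \<comment> \<open>A repeated injective tuple avoiding \<open>D\<close> would allow
      \<open>i\<close>, with partner \<open>j\<close>, to be added to the maximal family.\<close>
    assume "i \<noteq> j"
    have disj: "g i ` ?R \<inter> g l ` ?R = {}" if "l \<in> J" for l
      using ij(5) that unfolding D_def by blast
    hence "i \<notin> J" using R by blast
    moreover have "insert i J \<in> Fam"
      unfolding Fam_def mem_Collect_eq
    proof (intro conjI ballI impI)
      show "insert i J \<subseteq> {..<n}" using J ij(1) unfolding Fam_def by blast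
      show "inj_on (g l) ?R" "\<exists>j<n. j \<noteq> l \<and> g j = g l" if "l \<in> insert i J" for l
        using that J ij(2-4) \<open>i \<noteq> j\<close> unfolding Fam_def by auto
      show "g l ` ?R \<inter> g l' ` ?R = {}" if ll: "l \<in> insert i J" "l' \<in> insert i J" "l \<noteq> l'" for l l'
      proof -
        consider "l = i" "l' \<in> J" | "l' = i" "l \<in> J" | "l \<in> J" "l' \<in> J" using ll by blast
        thus ?thesis
        proof cases
          case 3
          thus ?thesis using J ll(3) unfolding Fam_def by blast
        qed (use disj in blast)+
      qed
    qed
    ultimately show False using max[of "insert i J"] by blast
  qed
  ultimately show ?thesis
    unfolding g_def by (intro exI[of _ "{..<m} - D"]) blast
qed

section \<open>Counting maps whose block tuples do not repeat\<close>

definition injective_tuples :: "nat \<Rightarrow> nat set \<Rightarrow> (nat \<Rightarrow> nat) set" where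
  "injective_tuples r E = {t \<in> {..<r} \<rightarrow>\<^sub>E E. inj_on t {..<r}}"

definition repeat_free :: "nat \<Rightarrow> 'a set \<Rightarrow> (nat \<Rightarrow> 'a) \<Rightarrow> bool" where
  "repeat_free n S g \<longleftrightarrow> (\<forall>i\<in>{..<n}. \<forall>j\<in>{..<n}. g i = g j \<longrightarrow> g i \<in> S \<longrightarrow> i = j)"

text \<open>The number is a falling factorial of \<open>card E\<close>, in which each of the
  \<open>r\<close> factors is at least \<open>m / 2 - r >= m / 4\<close>.\<close>

lemma card_injective_tuples_ge:
  assumes "finite E" "m \<le> 2 * card E" "4 * r \<le> m"
  shows "(real m / 4) ^ r \<le> real (card (injective_tuples r E))"
proof -
  have "(real m / 4) ^ r = (\<Prod>i<r. real m / 4)" by simp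
  also have "\<dots> \<le> (\<Prod>i<r. real (card E - i))"
    by (rule prod_mono) (use assms in auto)
  also have "\<dots> = real (card (injective_tuples r E))"
    unfolding injective_tuples_def by (subst card_injections) (use assms in auto)
  finally show ?thesis .
qed

text \<open>Division by \<open>q\<close> splits each value into a block below \<open>m\<close> and a
  remainder below \<open>q\<close>. The condition concerns only the blocks, so the remainders
  contribute all \<open>q ^ (r * n)\<close> choices.\<close>

lemma card_maps_repeat_free_le:
  fixes r m n q :: nat
  assumes "0 < q"
  defines "T \<equiv> {..<r} \<rightarrow>\<^sub>E {..<m}"
  shows "card {F \<in> cells r n \<rightarrow>\<^sub>E {..<m * q}. repeat_free n S (block_tuple r q F)}
    \<le> card {g \<in> {..<n} \<rightarrow>\<^sub>E T. repeat_free n S g} * q ^ (r * n)"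
proof -
  let ?A = "{F \<in> cells r n \<rightarrow>\<^sub>E {..<m * q}. repeat_free n S (block_tuple r q F)}"
  let ?B = "{g \<in> {..<n} \<rightarrow>\<^sub>E T. repeat_free n S g}" and ?C = "cells r n \<rightarrow>\<^sub>E {..<q}"
  define c where "c = (\<lambda>F. (restrict (block_tuple r q F) {..<n}, \<lambda>x\<in>cells r n. F x mod q))"
  have "finite ({..<n} \<rightarrow>\<^sub>E T)" by (auto simp: T_def intro!: finite_PiE)
  hence "finite ?B" by simp
  hence fin: "finite (?B \<times> ?C)" by (simp add: finite_PiE)
  have "inj_on c ?A"
  proof (rule inj_onI)
    fix F G assume *: "F \<in> ?A" "G \<in> ?A" "c F = c G"
    have "F x = G x" if cell: "x \<in> cells r n" for x
    proof -
      obtain i s where x: "x = (i, s)" "i < n" "s < r" using cell by (auto simp: cells_def)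
      have "restrict (block_tuple r q F) {..<n} i s = restrict (block_tuple r q G) {..<n} i s"
        using *(3) by (simp add: c_def)
      hence "F x div q = G x div q" using x by (simp add: block_tuple_def)
      moreover have "(\<lambda>x\<in>cells r n. F x mod q) x = (\<lambda>x\<in>cells r n. G x mod q) x"
        using *(3) by (simp add: c_def)
      hence "F x mod q = G x mod q" using cell by simp
      ultimately show ?thesis by (metis div_mult_mod_eq)
    qed
    thus "F = G" using *(1,2) by (blast intro: PiE_ext)
  qed
  moreover have "c ` ?A \<subseteq> ?B \<times> ?C"
  proof (rule image_subsetI)
    fix F assume F: "F \<in> ?A"
    have lt: "F (i, s) div q < m" if "i < n" "s < r" for i s
      using F that PiE_mem[of F "cells r n" "\<lambda>_. {..<m * q}" "(i, s)"]
      by (simp add: less_mult_imp_div_less cells_def)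
    have "block_tuple r q F i \<in> T" if "i < n" for i
      using lt[OF that] by (auto simp: block_tuple_def T_def)
    hence "restrict (block_tuple r q F) {..<n} \<in> ?B"
      using F by (simp add: repeat_free_def)
    moreover have "(\<lambda>x\<in>cells r n. F x mod q) \<in> ?C" using \<open>0 < q\<close> by simp
    ultimately show "c F \<in> ?B \<times> ?C" by (simp add: c_def)
  qed
  ultimately have "card ?A \<le> card (?B \<times> ?C)" using fin by (rule card_inj_on_le)
  thus ?thesis by (simp add: card_cartesian_product card_funcsetE)
qed

text \<open>The factor \<open>2\<close> pays for passing to all maps and \<open>2 ^ m\<close> for
  the choice of the block set \<open>E\<close>. The rest is the birthday bound for \<open>n\<close>
  tuples among \<open>m ^ r\<close>, of which at least \<open>(m / 4) ^ r\<close> must not repeat;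
  \<open>n <= m ^ r\<close> is its size condition.\<close>

lemma prob_small_twins:
  assumes "0 < r" "0 < n" "4 * r \<le> m" "2 * (r * (k - 1)) \<le> m" "n \<le> m ^ r"
  shows "measure_pmf.prob (random_matching r n) {M. max_twins M < k}
    \<le> 2 * 2 ^ m * (exp 1 * real n * exp (- (real n ^ 2 / (5 * 4 ^ r * real m ^ r))))"
proof -
  let ?L = "labellings r n" and ?X = "cells r n"
  let ?T = "{..<r} \<rightarrow>\<^sub>E {..<m}"
  define K where "K = r * n"
  \<comment> \<open>This block length makes \<open>N = m * q\<close> at least
    \<open>2 * K ^ 2\<close>, so that at least half of all maps are injective.\<close>
  define q where "q = 2 * K\<^sup>2"
  define N where "N = m * q"
  define X where "X = exp 1 * real n * exp (- (real n ^ 2 / (5 * 4 ^ r * real m ^ r)))"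
  define Es where "Es = {E. E \<subseteq> {..<m} \<and> m \<le> 2 * card E}"
  define A where "A = (\<lambda>E. {F \<in> ?X \<rightarrow>\<^sub>E {..<N}. repeat_free n (injective_tuples r E) (block_tuple r q F)})"
  have pos: "0 < K" "0 < q" "0 < m" using assms by (auto simp: K_def q_def)
  have "q \<le> N" using pos by (simp add: N_def)
  have fin: "finite Es" "card Es \<le> 2 ^ m"
  proof -
    have sub: "Es \<subseteq> Pow {..<m}" by (auto simp: Es_def)
    thus "finite Es" by (rule finite_subset) simp
    show "card Es \<le> 2 ^ m" using card_mono[OF _ sub] by (simp add: card_Pow)
  qed
  have A: "real (card (A E)) \<le> real N ^ K * X" if "E \<in> Es" for E
  proof -
    have E: "E \<subseteq> {..<m}" "m \<le> 2 * card E" using that by (auto simp: Es_def)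
    have finE: "finite E" using E(1) by (rule finite_subset) simp
    have cT: "card ?T = m ^ r" by (simp add: card_funcsetE)
    have sub: "injective_tuples r E \<subseteq> ?T"
      using PiE_mono[of "{..<r}" "\<lambda>_. E" "\<lambda>_. {..<m}"] E(1)
      unfolding injective_tuples_def by blast
    have "real n ^ 2 / (5 * 4 ^ r * real m ^ r)
        = (real m / 4) ^ r * (real n)\<^sup>2 / (5 * (real (m ^ r))\<^sup>2)"
      using pos by (simp add: power_divide power2_eq_square field_simps)
    also have "\<dots> \<le> real (card (injective_tuples r E)) * (real n)\<^sup>2 / (5 * (real (m ^ r))\<^sup>2)"
      by (intro divide_right_mono mult_right_mono card_injective_tuples_ge)
        (use assms(3) E(2) finE in auto)
    finally have ex: "real n ^ 2 / (5 * 4 ^ r * real m ^ r)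
        \<le> real (card (injective_tuples r E)) * (real n)\<^sup>2 / (5 * (real (m ^ r))\<^sup>2)" .
    have "real (card {g \<in> {..<n} \<rightarrow>\<^sub>E ?T. repeat_free n (injective_tuples r E) g})
       \<le> real (m ^ r) ^ n * (exp 1 * real n *
          exp (- (real (card (injective_tuples r E)) * (real n)\<^sup>2 / (5 * (real (m ^ r))\<^sup>2))))"
      using card_sequences_without_repeats_le_exp[OF sub, of "{..<n}"] assms(2,5)
      unfolding repeat_free_def by (simp add: cT finite_PiE)
    also have "\<dots> \<le> real (m ^ r) ^ n * X"
      unfolding X_def using ex by (intro mult_left_mono) auto
    finally have g: "real (card {g \<in> {..<n} \<rightarrow>\<^sub>E ?T. repeat_free n (injective_tuples r E) g})
       \<le> real m ^ K * X" by (simp add: K_def power_mult)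
    have "real (card (A E)) \<le> real (card {g \<in> {..<n} \<rightarrow>\<^sub>E ?T. repeat_free n (injective_tuples r E) g} * q ^ K)"
      unfolding A_def N_def K_def using card_maps_repeat_free_le[OF pos(2)] by (simp only: of_nat_le_iff)
    also have "\<dots> = real (card {g \<in> {..<n} \<rightarrow>\<^sub>E ?T. repeat_free n (injective_tuples r E) g}) * real q ^ K"
      by simp
    also have "\<dots> \<le> real m ^ K * X * real q ^ K" by (intro mult_right_mono g) simp
    also have "\<dots> = real N ^ K * X" by (simp add: N_def power_mult_distrib)
    finally show ?thesis .
  qed
  have "(N choose K) * card {h \<in> ?L. max_twins (matching_of r n h) < k}
      \<le> card {F \<in> ?X \<rightarrow>\<^sub>E {..<N}. \<exists>E\<in>Es. repeat_free n (injective_tuples r E) (block_tuple r q F)}"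
    unfolding K_def
  proof (rule card_labellings_le_card_maps)
    fix h and e :: "nat \<Rightarrow> nat"
    assume he: "h \<in> ?L" "max_twins (matching_of r n h) < k" "strict_mono_on {1..r * n} e"
    let ?F = "restrict (e \<circ> h) ?X"
    have F: "?F (i, s) = e (h (i, s))" if "i < n" "s < r" for i s
      using that by (simp add: cells_def)
    obtain E where E: "E \<subseteq> {..<m}" "m \<le> card E + r * (k - 1)"
      and rep: "\<forall>i<n. \<forall>j<n. block_tuple r q ?F i = block_tuple r q ?F j \<longrightarrow>
        inj_on (block_tuple r q ?F i) {..<r} \<longrightarrow> block_tuple r q ?F i ` {..<r} \<subseteq> E \<longrightarrow> i = j"
      using ex_blocks_without_repeats[OF \<open>0 < r\<close> he(1,3,2) F, where q = q and m = m] by blast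
    \<comment> \<open>The maximal family uses at most \<open>r * (k - 1) <= m / 2\<close> blocks, so
      at least half of them remain.\<close>
    have "E \<in> Es" using E assms(4) by (simp add: Es_def)
    moreover have "repeat_free n (injective_tuples r E) (block_tuple r q ?F)"
      unfolding repeat_free_def
    proof (intro ballI impI)
      fix i j assume *: "i \<in> {..<n}" "j \<in> {..<n}" "block_tuple r q ?F i = block_tuple r q ?F j"
        "block_tuple r q ?F i \<in> injective_tuples r E"
      hence "inj_on (block_tuple r q ?F i) {..<r}" "block_tuple r q ?F i ` {..<r} \<subseteq> E"
        by (auto simp only: injective_tuples_def PiE_iff mem_Collect_eq image_subset_iff)
      thus "i = j" using rep *(1-3) by blast
    qed
    ultimately show "\<exists>E\<in>Es. repeat_free n (injective_tuples r E) (block_tuple r q ?F)" by blast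
  qed
  also have "{F \<in> ?X \<rightarrow>\<^sub>E {..<N}. \<exists>E\<in>Es. repeat_free n (injective_tuples r E) (block_tuple r q F)}
      = (\<Union>E\<in>Es. A E)" by (auto simp: A_def)
  also have "card (\<Union>E\<in>Es. A E) \<le> (\<Sum>E\<in>Es. card (A E))" using fin(1) by (rule card_UN_le)
  finally have "real ((N choose K) * card {h \<in> ?L. max_twins (matching_of r n h) < k})
      \<le> real (\<Sum>E\<in>Es. card (A E))" by (simp only: of_nat_le_iff)
  hence "real (N choose K) * real (card {h \<in> ?L. max_twins (matching_of r n h) < k})
      \<le> (\<Sum>E\<in>Es. real (card (A E)))" by simp
  also have "\<dots> \<le> (\<Sum>E\<in>Es. real N ^ K * X)" by (intro sum_mono A)
  also have "\<dots> = real (card Es) * (real N ^ K * X)" by simp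
  also have "\<dots> \<le> 2 ^ m * (real N ^ K * X)"
  proof (rule mult_right_mono)
    have "real (card Es) \<le> real (2 ^ m)" using fin(2) by (simp only: of_nat_le_iff)
    thus "real (card Es) \<le> 2 ^ m" by simp
  qed (simp add: X_def)
  also have "\<dots> \<le> 2 ^ m * ((2 * (real (N choose K) * real (card ?L))) * X)"
  proof (intro mult_left_mono mult_right_mono)
    show "real N ^ K \<le> 2 * (real (N choose K) * real (card ?L))"
      using power_le_binomial_mult_card_labellings[of r n N] pos \<open>q \<le> N\<close>
      by (simp add: K_def q_def)
  qed (simp_all add: X_def)
  finally have "real (N choose K) * real (card {h \<in> ?L. max_twins (matching_of r n h) < k})
      \<le> real (N choose K) * (2 * 2 ^ m * X * real (card ?L))" by (simp add: mult_ac)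
  moreover have "0 < real (N choose K)"
  proof -
    have "K \<le> 2 * K\<^sup>2" by (simp add: power2_eq_square)
    thus ?thesis using \<open>q \<le> N\<close> by (simp add: q_def)
  qed
  ultimately have "real (card {h \<in> ?L. max_twins (matching_of r n h) < k}) \<le> 2 * 2 ^ m * X * real (card ?L)"
    by simp
  thus ?thesis
    using prob_random_matching[OF assms(1), of n "{M. max_twins M < k}"] card_labellings_pos[of r n]
    by (simp add: X_def divide_le_eq)
qed

section \<open>Asymptotics\<close>

text \<open>For \<open>y = n powr (2 / (r + 1))\<close> one has \<open>y ^ (r + 1) = n ^ 2\<close>,
  so the factor \<open>2 * exp 1\<close> is what the hypothesis of \<open>prob_large_twins\<close>
  asks for.\<close>

lemma tendsto_prob_large_twins:
  assumes "0 < r"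
  shows "(\<lambda>n. measure_pmf.prob (random_matching r n)
    {M. 2 * exp 1 * real n powr (2 / (real r + 1)) < real (max_twins M)}) \<longlonglongrightarrow> 0"
proof (rule tendsto_sandwich[of "\<lambda>_. 0"])
  define a where "a = 2 / (real r + 1)"
  have a: "0 < a" by (simp add: a_def)
  show "(\<lambda>n. (1 / 2) powr (real n powr a)) \<longlonglongrightarrow> 0"
    using a by real_asymp
  show "\<forall>\<^sub>F n in sequentially. measure_pmf.prob (random_matching r n)
    {M. 2 * exp 1 * real n powr (2 / (real r + 1)) < real (max_twins M)} \<le> (1 / 2) powr (real n powr a)"
  proof (rule eventually_mono[OF eventually_gt_at_top[of 0]])
    fix n :: nat assume "0 < n"
    define y where "y = real n powr a"
    \<comment> \<open>The least integer strictly above the threshold: floor plus one, because the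
      event is a strict inequality.\<close>
    define k where "k = nat \<lfloor>2 * exp 1 * y\<rfloor> + 1"
    have y: "0 < y" "y ^ (r + 1) = real n ^ 2"
    proof -
      show "0 < y" using \<open>0 < n\<close> by (simp add: y_def)
      have "y ^ (r + 1) = real n powr (a * real (r + 1))"
        unfolding y_def by (subst powr_power) (use \<open>0 < n\<close> in \<open>simp_all add: mult.commute\<close>)
      also have "a * real (r + 1) = real 2" by (simp add: a_def field_simps)
      finally show "y ^ (r + 1) = real n ^ 2" using \<open>0 < n\<close> by (simp only: powr_realpow of_nat_0_less_iff)
    qed
    have k: "2 * exp 1 * y \<le> real k" unfolding k_def by linarith
    have "(2 * exp 1) ^ (r + 1) * real n ^ 2 = (2 * exp 1 * y) ^ (r + 1)"
      unfolding power_mult_distrib y(2) ..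
    also have "\<dots> \<le> real k ^ (r + 1)" using k y(1) by (intro power_mono) auto
    finally have k2: "(2 * exp 1) ^ (r + 1) * real n ^ 2 \<le> real k ^ (r + 1)" .
    have "{M :: nat set set. 2 * exp 1 * y < real (max_twins M)} \<subseteq> {M. k \<le> max_twins M}"
      using y(1) by (auto simp: k_def Suc_le_eq nat_less_iff floor_less_iff)
    hence "measure_pmf.prob (random_matching r n) {M. 2 * exp 1 * y < real (max_twins M)}
        \<le> measure_pmf.prob (random_matching r n) {M. k \<le> max_twins M}"
      by (intro measure_pmf.finite_measure_mono) auto
    also have "\<dots> \<le> (1 / 2) ^ k" by (rule prob_large_twins[OF assms _ k2]) (simp add: k_def)
    also have "\<dots> = (1 / 2) powr real k" by (simp add: powr_realpow)
    also have "\<dots> \<le> (1 / 2) powr y"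
    proof (rule powr_mono')
      have "1 * y \<le> 2 * exp 1 * y"
        using y(1) exp_ge_add_one_self[of 1] by (intro mult_right_mono) auto
      thus "y \<le> real k" using k by simp
    qed auto
    finally show "measure_pmf.prob (random_matching r n)
      {M. 2 * exp 1 * real n powr (2 / (real r + 1)) < real (max_twins M)} \<le> (1 / 2) powr (real n powr a)"
      by (simp add: y_def a_def)
  qed
qed auto

text \<open>With \<open>m\<close> of order \<open>y = n powr (2 / (r + 1))\<close>, the birthday
  exponent \<open>n ^ 2 / m ^ r\<close> also has order \<open>y\<close>. The constants are chosen so
  that it outweighs \<open>2 ^ m\<close>.\<close>

lemma tendsto_prob_small_twins:
  assumes "2 \<le> r"
  shows "(\<lambda>n. measure_pmf.prob (random_matching r n)
    {M. real (max_twins M) < 1 / (64 * real r) * real n powr (2 / (real r + 1))}) \<longlonglongrightarrow> 0"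
proof (rule tendsto_sandwich[of "\<lambda>_. 0"])
  define a where "a = 2 / (real r + 1)"
  \<comment> \<open>The second fact expresses the balance \<open>n ^ 2 / y ^ r = y\<close>. The
    third needs \<open>r >= 2\<close> and makes the number \<open>m ^ r\<close> of tuples eventually
    exceed \<open>n\<close>.\<close>
  have a: "0 < a" "2 - a * real r = a" "1 < a * real r"
    using assms by (simp_all add: a_def field_simps)
  show "(\<lambda>n. 2 * exp 1 * real n * exp (- (real n powr a))) \<longlonglongrightarrow> 0"
    using a(1) by real_asymp
  \<comment> \<open>The first condition gives \<open>m >= y / 32 >= 4 * r\<close>, and the second
    gives \<open>n <= (y / 32) ^ r <= m ^ r\<close>.\<close>
  have ev: "\<forall>\<^sub>F n in sequentially. 128 * real r \<le> real n powr a"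
    "\<forall>\<^sub>F n in sequentially. 32 ^ r * real n \<le> real n powr (a * real r)"
    using a(1,3) by real_asymp+
  show "\<forall>\<^sub>F n in sequentially. measure_pmf.prob (random_matching r n)
      {M. real (max_twins M) < 1 / (64 * real r) * real n powr (2 / (real r + 1))}
      \<le> 2 * exp 1 * real n * exp (- (real n powr a))"
    using ev eventually_gt_at_top[of 0]
  proof eventually_elim
    fix n :: nat
    assume large: "128 * real r \<le> real n powr a" "32 ^ r * real n \<le> real n powr (a * real r)"
      and "0 < n"
    define y where "y = real n powr a"
    \<comment> \<open>With \<open>m <= y / 16\<close> the exponent
      \<open>n ^ 2 / (5 * 4 ^ r * m ^ r)\<close> is at least \<open>4 ^ r * y / 5\<close>, hence at
      least \<open>2 * y\<close> for \<open>r >= 2\<close>, whereas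
      \<open>2 ^ m <= exp (y / 16)\<close>.\<close>
    define m where "m = nat \<lfloor>y / 16\<rfloor>"
    \<comment> \<open>The ceiling satisfies \<open>k - 1 <= y / (64 * r)\<close>, so
      \<open>2 * r * (k - 1) <= y / 32 <= m\<close>. An integer below the real threshold is also
      below its ceiling.\<close>
    define k where "k = nat \<lceil>1 / (64 * real r) * y\<rceil>"
    have yr: "y ^ r = real n powr (a * real r)"
      unfolding y_def by (subst powr_power) (use \<open>0 < n\<close> in \<open>simp_all add: mult.commute\<close>)
    have y: "0 < y" "128 * real r \<le> y" using \<open>0 < n\<close> large(1) by (simp_all add: y_def)
    have m: "real m \<le> y / 16" "y / 32 \<le> real m"
    proof -
      show "real m \<le> y / 16" using y(1) of_int_floor_le[of "y / 16"] by (simp only: m_def of_nat_nat zero_le_floor)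
      have "y / 16 - 1 \<le> real m" unfolding m_def by linarith
      thus "y / 32 \<le> real m" using y(2) assms by simp
    qed
    have m0: "0 < real m" using m(2) y(1) by simp
    have m1: "4 * r \<le> m" using m(2) y(2) by linarith
    have m2: "2 * (r * (k - 1)) \<le> m"
    proof -
      have "real (nat \<lceil>z\<rceil> - 1) \<le> z" if "0 \<le> z" for z :: real
        using that by linarith
      hence "real (k - 1) \<le> 1 / (64 * real r) * y" using y(1) by (simp add: k_def)
      hence "2 * (real r * real (k - 1)) \<le> 2 * (real r * (1 / (64 * real r) * y))"
        by (intro mult_left_mono) auto
      also have "\<dots> = y / 32" using assms by simp
      finally have "real (2 * (r * (k - 1))) \<le> real m" using m(2) by simp
      thus ?thesis by (simp only: of_nat_le_iff)
    qed
    have m3: "n \<le> m ^ r"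
    proof -
      have "real n \<le> (y / 32) ^ r" using large(2) by (simp add: yr power_divide field_simps)
      also have "\<dots> \<le> real m ^ r" using m(2) y(1) by (intro power_mono) auto
      finally have "real n \<le> real (m ^ r)" by simp
      thus ?thesis by (simp only: of_nat_le_iff)
    qed
    have "(2 :: real) ^ m \<le> exp 1 ^ m"
      using exp_ge_add_one_self[of 1] by (intro power_mono) auto
    also have "\<dots> = exp (real m)" by (simp flip: exp_of_nat_mult)
    finally have e1: "2 ^ m \<le> exp (real m)" .
    have e2: "2 * y \<le> real n ^ 2 / (5 * 4 ^ r * real m ^ r)"
    proof -
      have "y * y ^ r = real n powr (a + a * real r)"
        unfolding yr by (simp add: y_def powr_add)
      also have "a + a * real r = real 2" using a(2) by simp
      also have "real n powr real 2 = real n ^ 2" using \<open>0 < n\<close> by (simp only: powr_realpow of_nat_0_less_iff)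
      finally have n2: "y * y ^ r = real n ^ 2" .
      have "(10 :: real) \<le> 4 ^ 2" by simp
      also have "(4 :: real) ^ 2 \<le> 4 ^ r" using assms by (intro power_increasing) auto
      finally have r4: "(10 :: real) \<le> 4 ^ r" .
      have "2 * y * (5 * 4 ^ r * real m ^ r) \<le> 2 * y * (5 * 4 ^ r * (y / 16) ^ r)"
        using m(1) y(1) by (intro mult_left_mono power_mono) auto
      also have "(y / 16) ^ r = y ^ r / (4 ^ r * 4 ^ r)"
        by (simp add: power_divide flip: power_mult_distrib)
      also have "2 * y * (5 * 4 ^ r * (y ^ r / (4 ^ r * 4 ^ r))) = 10 / 4 ^ r * real n ^ 2"
        by (simp add: n2[symmetric] field_simps)
      also have "\<dots> \<le> 1 * real n ^ 2" using r4 by (intro mult_right_mono) auto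
      finally show ?thesis using m0 by (simp add: le_divide_eq)
    qed
    have "{M :: nat set set. real (max_twins M) < 1 / (64 * real r) * y} \<subseteq> {M. max_twins M < k}"
      unfolding k_def by clarsimp linarith
    hence "measure_pmf.prob (random_matching r n) {M. real (max_twins M) < 1 / (64 * real r) * y}
        \<le> measure_pmf.prob (random_matching r n) {M. max_twins M < k}"
      by (intro measure_pmf.finite_measure_mono) auto
    also have "\<dots> \<le> 2 * 2 ^ m * (exp 1 * real n * exp (- (real n ^ 2 / (5 * 4 ^ r * real m ^ r))))"
      using assms \<open>0 < n\<close> m1 m2 m3 by (intro prob_small_twins) auto
    also have "\<dots> \<le> 2 * exp (real m) * (exp 1 * real n * exp (- (2 * y)))"
      using e1 e2 by (intro mult_mono mult_left_mono) auto
    also have "\<dots> = 2 * exp 1 * real n * exp (real m - 2 * y)"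
      by (simp add: exp_diff exp_minus field_simps)
    also have "\<dots> \<le> 2 * exp 1 * real n * exp (- y)"
      using m(1) y(1) by (intro mult_left_mono) auto
    finally show "measure_pmf.prob (random_matching r n)
      {M. real (max_twins M) < 1 / (64 * real r) * real n powr (2 / (real r + 1))}
      \<le> 2 * exp 1 * real n * exp (- (real n powr a))"
      by (simp add: y_def a_def)
  qed
qed auto

theorem theorem1p1:
  fixes r :: nat
  assumes "2 \<le> r"
  shows "\<exists>c C :: real. 0 < c \<and> c \<le> C \<and>
    (\<lambda>n. measure_pmf.prob (random_matching r n)
       {M. c * real n powr (2 / (real r + 1)) \<le> real (max_twins M) \<and>
           real (max_twins M) \<le> C * real n powr (2 / (real r + 1))}) \<longlonglongrightarrow> 1"
proof (intro exI conjI)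
  let ?c = "1 / (64 * real r)" and ?C = "2 * exp 1 :: real"
  let ?y = "\<lambda>n. real n powr (2 / (real r + 1))"
  let ?p = "\<lambda>n. measure_pmf.prob (random_matching r n)"
  let ?low = "\<lambda>n. {M :: nat set set. real (max_twins M) < ?c * ?y n}"
  let ?high = "\<lambda>n. {M :: nat set set. ?C * ?y n < real (max_twins M)}"
  let ?good = "\<lambda>n. {M :: nat set set. ?c * ?y n \<le> real (max_twins M) \<and> real (max_twins M) \<le> ?C * ?y n}"
  show "0 < ?c" using assms by simp
  have "?c \<le> 1" using assms by simp
  also have "1 \<le> ?C" using exp_ge_add_one_self[of 1] by simp
  finally show "?c \<le> ?C" .
  show "(\<lambda>n. ?p n (?good n)) \<longlonglongrightarrow> 1"
  proof (rule tendsto_sandwich)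
    show "\<forall>\<^sub>F n in sequentially. 1 - (?p n (?low n) + ?p n (?high n)) \<le> ?p n (?good n)"
    proof (rule always_eventually, rule allI)
      fix n
      have "?p n (?good n) = 1 - ?p n (?low n \<union> ?high n)"
        by (subst measure_pmf.prob_compl[symmetric]) (auto intro!: arg_cong[where f = "?p n"])
      moreover have "?p n (?low n \<union> ?high n) \<le> ?p n (?low n) + ?p n (?high n)"
        by (rule measure_Un_le) auto
      ultimately show "1 - (?p n (?low n) + ?p n (?high n)) \<le> ?p n (?good n)" by linarith
    qed
    have "(\<lambda>n. 1 - (?p n (?low n) + ?p n (?high n))) \<longlonglongrightarrow> 1 - (0 + 0)"
      using assms by (intro tendsto_intros tendsto_prob_small_twins tendsto_prob_large_twins) auto
    thus "(\<lambda>n. 1 - (?p n (?low n) + ?p n (?high n))) \<longlonglongrightarrow> 1" by simp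
  qed auto
qed

end
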